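(* Let $A=\{a_1,\ldots,a_m\}$ be a finite set of distinct real numbers. For every non-negative integer $n$, the characteristic polynomial of $\mathcal{B}_n^A$ satisfies \[ \chi_{\mathcal{B}_n^A}(t)=\sum_{l=0}^n(-1)^{n-l}\,r_l(\mathcal{B}_n^A)\binom{t}{l}, \] with the convention $\chi_{\mathcal{B}_0^A}(t)=1$.
   Context: For a finite set $A$ of real numbers and $n\ge 0$, $\mathcal{B}_n^A$ is the hyperplane arrangement in $\mathbb{R}^n$ consisting of the hyperplanes $x_i-x_j=a$ for all $1\le i<j\le n$ and $a\in A$. The characteristic polynomial of an arrangement $\mathcal{A}$ in $\mathbb{R}^n$ is $\chi_{\mathcal{A}}(t)=\sum (-1)^{|\mathcal{B}|}t^{\dim(\bigcap_{H\in\mathcal{B}}H)}$, the sum over all subsets $\mathcal{B}\subseteq\mathcal{A}$ with $\bigcap_{H\in\mathcal{B}}H\neq\emptyset$ (the empty intersection being $\mathbb{R}^n$). A region is a connected component of the complement of the union of the hyperplanes. The level $l(X)$ of $X\subseteq\mathbb{R}^n$ is the smallest non-negative integer $l$ such that there exist a linear subspace $W$ of dimension $l$ and $r>0$ with $X\subseteq\{\bm x:\min_{\bm w\in W}\|\bm x-\bm w\|\le r\}$. $r_l(\mathcal{A})$ is the number of regions of level $l$, with $r_0=1$ for the arrangement in $\mathbb{R}^0$. $\binom{t}{l}=t(t-1)\cdots(t-l+1)/l!$.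
   Formalization: The set A is assumed nonempty (m ≥ 1): for A empty and n = 2 the arrangement is empty, so the characteristic polynomial is t², while the right-hand side is t(t−1)/2, so the identity fails. *)

theory Defs
  imports
    "HOL-Analysis.Analysis"
    "HOL-Library.Function_Algebras"
    "HOL-Computational_Algebra.Polynomial"
begin

text \<open>
  For a dimension \<open>n\<close> that is an ordinary natural number (including \<open>0\<close>), \<open>\<real>\<^sup>n\<close> is the library space
  \<^term>\<open>Euclidean_space n\<close>: the functions \<open>x :: nat \<Rightarrow> real\<close> with \<open>x i = 0\<close> for all \<open>i \<ge> n\<close>,
  so the coordinates \<open>x\<^sub>1, \<dots>, x\<^sub>n\<close> are \<open>x 0, \<dots>, x (n - 1)\<close>. The pointwise real vector space
  structure on functions supplies \<^const>\<open>subspace\<close> and \<^const>\<open>dim\<close>.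
\<close>

instantiation "fun" :: (type, real_vector) real_vector
begin

definition scaleR_fun_def: "scaleR r f = (\<lambda>x. scaleR r (f x))"

instance
  by standard (simp_all add: scaleR_fun_def fun_eq_iff scaleR_add_left scaleR_add_right)

end

definition euclid_dist :: "nat \<Rightarrow> (nat \<Rightarrow> real) \<Rightarrow> (nat \<Rightarrow> real) \<Rightarrow> real" where
  "euclid_dist n x y = L2_set (\<lambda>i. x i - y i) {..<n}"

text \<open>The library's \<^const>\<open>aff_dim\<close> is restricted to \<^class>\<open>euclidean_space\<close>; the dimension of a
  nonempty affine subspace is that of its space of differences.\<close>

definition affine_dim :: "(nat \<Rightarrow> real) set \<Rightarrow> nat" where
  "affine_dim F = dim {x - y | x y. x \<in> F \<and> y \<in> F}"

definition flat :: "nat \<Rightarrow> (nat \<Rightarrow> real) set set \<Rightarrow> (nat \<Rightarrow> real) set" where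
  "flat n B = topspace (Euclidean_space n) \<inter> \<Inter>B"

definition arrangement_poly :: "nat \<Rightarrow> (nat \<Rightarrow> real) set set \<Rightarrow> real poly" where
  "arrangement_poly n \<A> =
    (\<Sum>B | B \<subseteq> \<A> \<and> flat n B \<noteq> {}. monom ((-1) ^ card B) (affine_dim (flat n B)))"

definition regions :: "nat \<Rightarrow> (nat \<Rightarrow> real) set set \<Rightarrow> (nat \<Rightarrow> real) set set" where
  "regions n \<A> = connected_components_of (subtopology (Euclidean_space n) (- \<Union>\<A>))"

text \<open>The infimum below is attained, \<open>W\<close> being a finite-dimensional subspace.\<close>

definition level :: "nat \<Rightarrow> (nat \<Rightarrow> real) set \<Rightarrow> nat" where
  "level n X = (LEAST l. \<exists>W r. subspace W \<and> W \<subseteq> topspace (Euclidean_space n) \<and> dim W = l \<and> r > 0 \<and>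
     X \<subseteq> {x \<in> topspace (Euclidean_space n). (INF w\<in>W. euclid_dist n x w) \<le> r})"

definition num_regions :: "nat \<Rightarrow> (nat \<Rightarrow> real) set set \<Rightarrow> nat \<Rightarrow> nat" where
  "num_regions n \<A> l = card {R \<in> regions n \<A>. level n R = l}"

definition difference_arrangement :: "nat \<Rightarrow> real set \<Rightarrow> (nat \<Rightarrow> real) set set" where
  "difference_arrangement n A =
    {{x \<in> topspace (Euclidean_space n). x i - x j = a} | i j a. i < j \<and> j < n \<and> a \<in> A}"

lemma topspace_Euclidean_space_0: "topspace (Euclidean_space 0) = {0}"
  by (auto simp: topspace_Euclidean_space fun_eq_iff)

lemma difference_arrangement_0: "difference_arrangement 0 A = {}"
  by (simp add: difference_arrangement_def)

lemma dim_singleton_zero: "dim {0 :: nat \<Rightarrow> real} = 0"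
  by (rule dim_unique[of "{}"]) (auto simp: independent_empty)

text \<open>The conventions for \<open>n = 0\<close> are consequences of the definitions.\<close>

lemma arrangement_poly_0: "arrangement_poly 0 (difference_arrangement 0 A) = 1"
proof -
  have "flat 0 {} = {0}"
    by (simp add: flat_def topspace_Euclidean_space_0)
  moreover have "{B. B \<subseteq> {} \<and> flat 0 B \<noteq> {}} = {{}}"
    using calculation by auto
  moreover have "affine_dim {0} = 0"
    by (simp add: affine_dim_def dim_singleton_zero)
  ultimately show ?thesis
    by (simp add: arrangement_poly_def difference_arrangement_0)
qed

lemma num_regions_0: "num_regions 0 (difference_arrangement 0 A) 0 = 1"
proof -
  have "regions 0 {} = {{0}}"
  proof -
    have "connected_component_of_set (Euclidean_space 0) 0 = {0}"
      using connected_component_of_subset_topspace[of "Euclidean_space 0" 0]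
        connected_component_of_refl[of "Euclidean_space 0" 0]
      by (auto simp: topspace_Euclidean_space_0)
    then show ?thesis
      by (simp add: regions_def connected_components_of_def topspace_Euclidean_space_0)
  qed
  moreover have "level 0 {0} = 0"
    unfolding level_def
    by (rule Least_eq_0, rule exI[of _ "{0}"], rule exI[of _ 1])
      (simp add: topspace_Euclidean_space_0 euclid_dist_def dim_singleton_zero)
  ultimately have "{R \<in> regions 0 {}. level 0 R = 0} = {{0}}"
    by auto
  then show ?thesis
    by (simp add: num_regions_def difference_arrangement_0)
qed

end

theory Submission
  imports Defs
begin

text \<open>
  Both sides are polynomials in \<open>t\<close>, so it suffices to compare them at \<open>t = -k\<close> for integers
  \<open>k \<ge> 1\<close>. For a colouring \<open>f : {1..n} \<rightarrow> {1..k}\<close> let \<open>\<A>\<^sub>f\<close> consist of the hyperplanes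
  \<open>x\<^sub>i - x\<^sub>j = a\<close> with \<open>f i = f j\<close>. A central subarrangement with flat of dimension \<open>d\<close> is
  contained in \<open>\<A>\<^sub>f\<close> for exactly \<open>k\<^sup>d\<close> colourings \<open>f\<close>; hence, by Zaslavsky's
  theorem, \<open>(-1)\<^sup>n \<chi>(-k)\<close> is the sum over all \<open>f\<close> of the number of regions of \<open>\<A>\<^sub>f\<close>.

  Attach to a region of the full arrangement the digraph with an edge \<open>i \<rightarrow> j\<close> whenever \<open>x\<^sub>j - x\<^sub>i\<close>
  is bounded below on it. Pushing the colour classes of \<open>f\<close> far apart identifies the regions of
  \<open>\<A>\<^sub>f\<close> with the regions of the full arrangement along whose digraph \<open>f\<close> is weakly increasing.
  As \<open>A\<close> is nonempty, any two vertices are joined by an edge, so the strong components are linearly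
  ordered; if there are \<open>m\<close> of them, there are \<open>k + m - 1\<close> choose \<open>m\<close> weakly increasing \<open>f\<close>,
  which is \<open>(-1)\<^sup>m\<close> times \<open>-k\<close> choose \<open>m\<close>. Finally \<open>m\<close> is the level of the region: the directions
  in which the region is unbounded span the space of vectors constant on strong components.
\<close>

section \<open>Dimension\<close>

lemma dim_mono_finite_span:
  fixes U W S :: "'v::real_vector set"
  assumes "finite S" "W \<subseteq> span S" "U \<subseteq> W"
  shows "dim U \<le> dim W"
proof -
  obtain B where B: "B \<subseteq> W" "independent B" "W \<subseteq> span B" "card B = dim W"
    by (rule basis_exists)
  moreover have "finite B"
    using independent_span_bound[OF assms(1) B(2)] B(1) assms(2) by auto
  ultimately show ?thesis
    using dim_le_card[of U B] assms(3) by auto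
qed

lemma dim_kernel_Suc:
  fixes L :: "'v::real_vector \<Rightarrow> real"
  assumes "finite S" and U: "subspace U" "U \<subseteq> span S"
    and L: "linear L" and v: "v \<in> U" "L v \<noteq> 0"
  shows "dim U = Suc (dim (U \<inter> {x. L x = 0}))"
proof -
  let ?K = "U \<inter> {x. L x = 0}"
  have K: "subspace ?K"
    by (intro subspace_inter U(1) linear_subspace_kernel L)
  obtain B where B: "B \<subseteq> ?K" "independent B" "?K \<subseteq> span B" "card B = dim ?K"
    by (rule basis_exists)
  have "finite B"
    using independent_span_bound[OF assms(1) B(2)] B(1) U(2) by auto
  have spanB: "span B = ?K"
    using span_minimal[OF B(1) K] B(3) by (rule subset_antisym)
  then have vB: "v \<notin> span B"
    using v by auto
  show ?thesis
  proof (rule dim_unique)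
    show "insert v B \<subseteq> U"
      using v B(1) by auto
    show "independent (insert v B)"
      using vB B(2) by (rule independent_insertI)
    show "card (insert v B) = Suc (dim ?K)"
      using \<open>finite B\<close> B(4) vB by (metis card_insert_disjoint span_base)
    show "U \<subseteq> span (insert v B)"
    proof
      fix x assume "x \<in> U"
      then have "x - (L x / L v) *\<^sub>R v \<in> ?K"
        using v U(1) L by (simp add: subspace_diff subspace_scale linear_diff linear_scale)
      then show "x \<in> span (insert v B)"
        unfolding span_insert spanB by blast
    qed
  qed
qed

lemma affine_as_translated_subspace:
  fixes V :: "'v::real_vector set"
  assumes "affine V" "x \<in> V"
  obtains U where "subspace U" "V = (+) x ` U"
proof (rule that)
  show "subspace ((\<lambda>z. z - x) ` V)"
    by (rule affine_diffs_subspace_subtract[OF assms])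
qed (simp add: image_image)

lemma affine_dim_translation:
  assumes "subspace U"
  shows "affine_dim ((+) x ` U) = dim U"
proof -
  have "{y - z | y z. y \<in> (+) x ` U \<and> z \<in> (+) x ` U} = U"
  proof (intro subset_antisym subsetI)
    fix u assume "u \<in> U"
    then have "x + u \<in> (+) x ` U" "x + 0 \<in> (+) x ` U"
      using assms subspace_0 by blast+
    moreover have "u = (x + u) - (x + 0)"
      by simp
    ultimately show "u \<in> {y - z | y z. y \<in> (+) x ` U \<and> z \<in> (+) x ` U}"
      by blast
  qed (use assms in \<open>auto simp: subspace_diff\<close>)
  then show ?thesis
    by (simp add: affine_dim_def)
qed

lemma affine_dim_subspace: "subspace U \<Longrightarrow> affine_dim U = dim U"
  using affine_dim_translation[of U 0] by simp

lemma affine_level_set: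
  fixes L :: "'v::real_vector \<Rightarrow> real"
  assumes "affine V" "linear L"
  shows "affine (V \<inter> {x. L x = c})"
  using assms by (auto simp: affine_def linear_add linear_scale simp flip: distrib_right)

lemma affine_dim_hyperplane_section:
  fixes L :: "(nat \<Rightarrow> real) \<Rightarrow> real"
  assumes "finite S" and V: "affine V" "V \<subseteq> span S"
    and L: "linear L" and x: "x \<in> V" "L x = c" and y: "y \<in> V" "L y \<noteq> c"
  shows "affine_dim V = Suc (affine_dim (V \<inter> {x. L x = c}))"
proof -
  obtain U where U: "subspace U" and V_eq: "V = (+) x ` U"
    by (rule affine_as_translated_subspace[OF V(1) x(1)])
  have "U \<subseteq> span S"
  proof
    fix u assume "u \<in> U"
    then have "(x + u) - x \<in> span S"
      using V(2) x(1) unfolding V_eq by (intro span_diff) auto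
    then show "u \<in> span S"
      by simp
  qed
  moreover obtain v where "v \<in> U" "L v \<noteq> 0"
    using y x(2) L by (auto simp: V_eq linear_add)
  ultimately have "dim U = Suc (dim (U \<inter> {u. L u = 0}))"
    using dim_kernel_Suc[OF assms(1) U _ L] by blast
  moreover have "V \<inter> {x. L x = c} = (+) x ` (U \<inter> {u. L u = 0})"
    using x(2) L by (auto simp: V_eq linear_add)
  moreover have "subspace (U \<inter> {u. L u = 0})"
    by (intro subspace_inter U linear_subspace_kernel L)
  ultimately show ?thesis
    using U by (simp only: V_eq affine_dim_translation)
qed

section \<open>Functions constant on fibres\<close>

definition constant_on_fibres :: "'a set \<Rightarrow> ('a \<Rightarrow> 'b) \<Rightarrow> ('a \<Rightarrow> 'c) \<Rightarrow> bool" where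
  "constant_on_fibres S \<rho> f \<longleftrightarrow> (\<forall>i\<in>S. \<forall>j\<in>S. \<rho> i = \<rho> j \<longrightarrow> f i = f j)"

lemma constant_on_fibres_iff_factors:
  "constant_on_fibres S \<rho> f \<longleftrightarrow> (\<exists>h. \<forall>i\<in>S. f i = h (\<rho> i))"
  using function_factors_left_gen[of "\<lambda>i. i \<in> S" \<rho> f]
  unfolding constant_on_fibres_def by blast

definition fibre_constant_space :: "nat \<Rightarrow> (nat \<Rightarrow> 'b) \<Rightarrow> (nat \<Rightarrow> real) set" where
  "fibre_constant_space n \<rho> =
    {y \<in> topspace (Euclidean_space n). constant_on_fibres {..<n} \<rho> y}"

definition fibre_indicator :: "nat \<Rightarrow> (nat \<Rightarrow> 'b) \<Rightarrow> 'b \<Rightarrow> nat \<Rightarrow> real" where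
  "fibre_indicator n \<rho> b = (\<lambda>i. if i < n \<and> \<rho> i = b then 1 else 0)"

lemma sum_fun_apply: "(\<Sum>i\<in>I. f i) x = (\<Sum>i\<in>I. f i x)"
  for f :: "'i \<Rightarrow> 'b \<Rightarrow> 'c::comm_monoid_add"
  by (induction I rule: infinite_finite_induct) auto

lemma fibre_constant_space_iff:
  "y \<in> fibre_constant_space n \<rho> \<longleftrightarrow> (\<exists>h. y = (\<lambda>i. if i < n then h (\<rho> i) else 0))"
  by (auto simp: fibre_constant_space_def constant_on_fibres_iff_factors topspace_Euclidean_space
      fun_eq_iff not_less)

lemma subspace_fibre_constant_space: "subspace (fibre_constant_space n \<rho>)"
proof (rule subspaceI)
  show "0 \<in> fibre_constant_space n \<rho>"
    by (auto simp: fibre_constant_space_iff fun_eq_iff intro!: exI[of _ "\<lambda>b. 0"])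
  fix x y c
  assume "x \<in> fibre_constant_space n \<rho>"
  then obtain g where g: "x = (\<lambda>i. if i < n then g (\<rho> i) else 0)"
    by (auto simp: fibre_constant_space_iff)
  then show "c *\<^sub>R x \<in> fibre_constant_space n \<rho>"
    by (auto simp: fibre_constant_space_iff fun_eq_iff scaleR_fun_def
        intro!: exI[of _ "\<lambda>b. c * g b"])
  assume "y \<in> fibre_constant_space n \<rho>"
  then obtain h where "y = (\<lambda>i. if i < n then h (\<rho> i) else 0)"
    by (auto simp: fibre_constant_space_iff)
  with g show "x + y \<in> fibre_constant_space n \<rho>"
    by (auto simp: fibre_constant_space_iff fun_eq_iff intro!: exI[of _ "\<lambda>b. g b + h b"])
qed

lemma fibre_indicator_sum_apply:
  "(\<Sum>b\<in>\<rho> ` {..<n}. h b *\<^sub>R fibre_indicator n \<rho> b) i = (if i < n then h (\<rho> i) else 0)"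
proof -
  have "(\<Sum>b\<in>\<rho> ` {..<n}. h b *\<^sub>R fibre_indicator n \<rho> b) i
      = (\<Sum>b\<in>\<rho> ` {..<n}. if b = \<rho> i then (if i < n then h b else 0) else 0)"
    unfolding sum_fun_apply by (rule sum.cong) (auto simp: scaleR_fun_def fibre_indicator_def)
  then show ?thesis
    by simp
qed

lemma fibre_constant_space_eq_sums:
  "fibre_constant_space n \<rho> = range (\<lambda>h. \<Sum>b\<in>\<rho> ` {..<n}. h b *\<^sub>R fibre_indicator n \<rho> b)"
  by (auto simp: fibre_constant_space_iff image_iff fun_eq_iff fibre_indicator_sum_apply)

lemma span_fibre_indicator:
  "span (fibre_indicator n \<rho> ` \<rho> ` {..<n}) = fibre_constant_space n \<rho>"
proof (rule span_unique)
  show "fibre_indicator n \<rho> ` \<rho> ` {..<n} \<subseteq> fibre_constant_space n \<rho>"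
    by (auto simp: fibre_constant_space_def fibre_indicator_def constant_on_fibres_def
        topspace_Euclidean_space)
  show "fibre_constant_space n \<rho> \<subseteq> W"
    if "fibre_indicator n \<rho> ` \<rho> ` {..<n} \<subseteq> W" "subspace W" for W
    unfolding fibre_constant_space_eq_sums
    using that by (auto intro!: subspace_sum subspace_scale)
qed (rule subspace_fibre_constant_space)

lemma inj_on_fibre_indicator: "inj_on (fibre_indicator n \<rho>) (\<rho> ` {..<n})"
proof (rule inj_onI)
  fix b c
  assume "b \<in> \<rho> ` {..<n}" and eq: "fibre_indicator n \<rho> b = fibre_indicator n \<rho> c"
  then obtain i where "i < n" "\<rho> i = b" by auto
  then show "b = c"
    using fun_cong[OF eq, of i] by (auto simp: fibre_indicator_def split: if_splits)
qed

lemma independent_fibre_indicator: "independent (fibre_indicator n \<rho> ` \<rho> ` {..<n})"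
proof (rule independent_if_scalars_zero)
  fix u v
  assume sum0: "(\<Sum>x\<in>fibre_indicator n \<rho> ` \<rho> ` {..<n}. u x *\<^sub>R x) = 0"
    and "v \<in> fibre_indicator n \<rho> ` \<rho> ` {..<n}"
  then obtain i where i: "i < n" "v = fibre_indicator n \<rho> (\<rho> i)" by auto
  have "(\<Sum>b\<in>\<rho> ` {..<n}. u (fibre_indicator n \<rho> b) *\<^sub>R fibre_indicator n \<rho> b) = 0"
    using sum0 by (simp add: sum.reindex inj_on_fibre_indicator)
  from fun_cong[OF this, of i] show "u v = 0"
    using i by (simp add: fibre_indicator_sum_apply)
qed simp

lemma dim_fibre_constant_space: "dim (fibre_constant_space n \<rho>) = card (\<rho> ` {..<n})"
  using dim_span_eq_card_independent[OF independent_fibre_indicator, of n \<rho>]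
  by (simp add: span_fibre_indicator card_image inj_on_fibre_indicator)

lemma Euclidean_space_eq_fibre_constant_space:
  "topspace (Euclidean_space n) = fibre_constant_space n id"
  by (auto simp: fibre_constant_space_def constant_on_fibres_def)

lemma subspace_Euclidean_space: "subspace (topspace (Euclidean_space n))"
  unfolding Euclidean_space_eq_fibre_constant_space by (rule subspace_fibre_constant_space)

lemma dim_Euclidean_space: "dim (topspace (Euclidean_space n)) = n"
  by (simp add: Euclidean_space_eq_fibre_constant_space dim_fibre_constant_space)

lemma Euclidean_space_finite_span:
  obtains S where "finite S" "topspace (Euclidean_space n) = span S"
  using span_fibre_indicator[of n id]
  by (metis Euclidean_space_eq_fibre_constant_space finite_imageI finite_lessThan)

lemma bij_betw_constant_on_fibres:
  "bij_betw (\<lambda>h. restrict (h \<circ> \<rho>) S) (\<rho> ` S \<rightarrow>\<^sub>E T) {f \<in> S \<rightarrow>\<^sub>E T. constant_on_fibres S \<rho> f}"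
proof (rule bij_betw_imageI)
  show "inj_on (\<lambda>h. restrict (h \<circ> \<rho>) S) (\<rho> ` S \<rightarrow>\<^sub>E T)"
  proof (rule inj_onI)
    fix g h
    assume gh: "g \<in> \<rho> ` S \<rightarrow>\<^sub>E T" "h \<in> \<rho> ` S \<rightarrow>\<^sub>E T"
      and eq: "restrict (g \<circ> \<rho>) S = restrict (h \<circ> \<rho>) S"
    show "g = h"
    proof (rule PiE_ext[OF gh])
      fix b assume "b \<in> \<rho> ` S"
      then obtain i where "i \<in> S" "b = \<rho> i" by auto
      then show "g b = h b" using fun_cong[OF eq, of i] by simp
    qed
  qed
  show "(\<lambda>h. restrict (h \<circ> \<rho>) S) ` (\<rho> ` S \<rightarrow>\<^sub>E T) = {f \<in> S \<rightarrow>\<^sub>E T. constant_on_fibres S \<rho> f}"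
  proof (intro subset_antisym subsetI)
    fix f assume f: "f \<in> {f \<in> S \<rightarrow>\<^sub>E T. constant_on_fibres S \<rho> f}"
    then obtain h where h: "\<forall>i\<in>S. f i = h (\<rho> i)"
      by (auto simp: constant_on_fibres_iff_factors)
    have "restrict h (\<rho> ` S) \<in> \<rho> ` S \<rightarrow>\<^sub>E T"
      using f h by (auto simp: PiE_iff)
    moreover have "f = restrict (restrict h (\<rho> ` S) \<circ> \<rho>) S"
      using f h by (intro extensionalityI[of _ S]) (auto simp: PiE_iff)
    ultimately show "f \<in> (\<lambda>h. restrict (h \<circ> \<rho>) S) ` (\<rho> ` S \<rightarrow>\<^sub>E T)"
      by blast
  qed (auto simp: PiE_iff constant_on_fibres_def)
qed

lemma card_constant_on_fibres:
  assumes "finite S"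
  shows "card {f \<in> S \<rightarrow>\<^sub>E T. constant_on_fibres S \<rho> f} = card T ^ card (\<rho> ` S)"
  using bij_betw_same_card[OF bij_betw_constant_on_fibres, of \<rho> S T] assms
  by (simp add: card_funcsetE)

section \<open>Counting monotone functions\<close>

lemma card_sorted_lists:
  assumes "finite T"
  shows "card {xs. sorted xs \<and> length xs = m \<and> set xs \<subseteq> T} = (card T + m - 1) choose m"
proof -
  have "bij_betw mset {xs. sorted xs \<and> length xs = m \<and> set xs \<subseteq> T} (multisets_of_size T m)"
    by (rule bij_betw_byWitness[where f' = sorted_list_of_multiset])
      (auto simp: multisets_of_size_def sorted_sort_id simp flip: size_mset)
  then show ?thesis
    using card_multisets_of_size[OF assms] by (simp add: bij_betw_same_card)
qed

lemma sorted_list_eq_map_mono_on: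
  fixes bs :: "'a::linorder list" and xs :: "'b::linorder list"
  assumes "sorted xs" "sorted_wrt (<) bs" and len: "length xs = length bs"
  obtains h where "mono_on (set bs) h" "map h bs = xs"
proof
  let ?h = "\<lambda>b. the (map_of (zip bs xs) b)"
  have nth: "?h (bs ! i) = xs ! i" if "i < length bs" for i
    using that len assms(2) by (simp add: map_of_zip_nth strict_sorted_iff)
  then show "map ?h bs = xs"
    using assms(3) by (intro nth_equalityI) auto
  show "mono_on (set bs) ?h"
  proof (rule mono_onI)
    fix b c assume "b \<in> set bs" "c \<in> set bs" "b \<le> c"
    then obtain i j where ij: "i < length bs" "b = bs ! i" "j < length bs" "c = bs ! j"
      by (auto simp: in_set_conv_nth)
    then have "\<not> j < i"
      using assms(2) \<open>b \<le> c\<close> sorted_wrt_nth_less[of "(<)" bs j i] by force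
    then show "?h b \<le> ?h c"
      using ij nth assms(1,3) by (auto intro: sorted_nth_mono)
  qed
qed

lemma card_mono_on_functions:
  fixes L :: "'a::linorder set" and T :: "'b::linorder set"
  assumes L: "finite L" and T: "finite T"
  shows "card {h \<in> L \<rightarrow>\<^sub>E T. mono_on L h} = (card T + card L - 1) choose card L"
proof -
  define bs where "bs = sorted_list_of_set L"
  have bs: "sorted_wrt (<) bs" "set bs = L" "length bs = card L"
    using L by (simp_all add: bs_def)
  have "bij_betw (\<lambda>h. map h bs) {h \<in> L \<rightarrow>\<^sub>E T. mono_on L h}
      {xs. sorted xs \<and> length xs = card L \<and> set xs \<subseteq> T}"
  proof (rule bij_betw_imageI)
    show "inj_on (\<lambda>h. map h bs) {h \<in> L \<rightarrow>\<^sub>E T. mono_on L h}"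
      by (rule inj_onI) (use bs(2) in \<open>auto intro: PiE_ext\<close>)
    show "(\<lambda>h. map h bs) ` {h \<in> L \<rightarrow>\<^sub>E T. mono_on L h}
        = {xs. sorted xs \<and> length xs = card L \<and> set xs \<subseteq> T}"
    proof (intro subset_antisym subsetI)
      fix xs assume "xs \<in> (\<lambda>h. map h bs) ` {h \<in> L \<rightarrow>\<^sub>E T. mono_on L h}"
      then obtain h where h: "h \<in> L \<rightarrow>\<^sub>E T" "mono_on L h" "xs = map h bs"
        by auto
      then have "sorted xs"
        using sorted_wrt_mono_rel[OF _ bs(1), of "\<lambda>x y. h x \<le> h y"] bs(2)
        by (simp add: sorted_map mono_onD)
      then show "xs \<in> {xs. sorted xs \<and> length xs = card L \<and> set xs \<subseteq> T}"
        using h bs by auto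
    next
      fix xs assume xs: "xs \<in> {xs. sorted xs \<and> length xs = card L \<and> set xs \<subseteq> T}"
      then obtain h where h: "mono_on L h" "map h bs = xs"
        using sorted_list_eq_map_mono_on[of xs bs] bs by auto
      then have "restrict h L \<in> {h \<in> L \<rightarrow>\<^sub>E T. mono_on L h}" "xs = map (restrict h L) bs"
        using xs bs(2) by (auto simp: monotone_on_def)
      then show "xs \<in> (\<lambda>h. map h bs) ` {h \<in> L \<rightarrow>\<^sub>E T. mono_on L h}"
        by blast
    qed
  qed
  then show ?thesis
    using card_sorted_lists[OF T] by (simp add: bij_betw_same_card)
qed

lemma card_rank_monotone_functions:
  fixes \<rho> :: "'a \<Rightarrow> 'b::linorder" and T :: "'c::linorder set"
  assumes "finite S" "finite T"
  shows "card {f \<in> S \<rightarrow>\<^sub>E T. \<forall>i\<in>S. \<forall>j\<in>S. \<rho> i \<le> \<rho> j \<longrightarrow> f i \<le> f j} =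
    (card T + card (\<rho> ` S) - 1) choose card (\<rho> ` S)"
proof -
  let ?F = "{f \<in> S \<rightarrow>\<^sub>E T. \<forall>i\<in>S. \<forall>j\<in>S. \<rho> i \<le> \<rho> j \<longrightarrow> f i \<le> f j}"
  let ?H = "{h \<in> \<rho> ` S \<rightarrow>\<^sub>E T. mono_on (\<rho> ` S) h}"
  let ?u = "\<lambda>h. restrict (h \<circ> \<rho>) S"
  have bij: "bij_betw ?u (\<rho> ` S \<rightarrow>\<^sub>E T) {f \<in> S \<rightarrow>\<^sub>E T. constant_on_fibres S \<rho> f}"
    by (rule bij_betw_constant_on_fibres)
  have mono_iff: "?u h \<in> ?F \<longleftrightarrow> h \<in> ?H" if "h \<in> \<rho> ` S \<rightarrow>\<^sub>E T" for h
    using that by (auto simp: monotone_on_def PiE_iff)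
  have "?F = ?u ` ?H"
  proof (intro subset_antisym subsetI)
    fix f assume f: "f \<in> ?F"
    then have "constant_on_fibres S \<rho> f"
      by (auto simp: constant_on_fibres_def intro: antisym)
    then have "f \<in> ?u ` (\<rho> ` S \<rightarrow>\<^sub>E T)"
      using f bij by (simp add: bij_betw_def)
    then show "f \<in> ?u ` ?H"
      using f mono_iff by blast
  qed (use mono_iff in blast)
  moreover have "inj_on ?u ?H"
    using bij by (auto simp: bij_betw_def intro: inj_on_subset)
  ultimately have "card ?F = card ?H"
    by (simp add: card_image)
  then show ?thesis
    using assms by (simp add: card_mono_on_functions)
qed

section \<open>Functions constant or increasing along edges\<close>

definition edge_class :: "('a \<times> 'a) set \<Rightarrow> 'a \<Rightarrow> 'a set" where
  "edge_class E i = (E \<union> E\<inverse>)\<^sup>* `` {i}"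

lemma edge_class_eq_iff: "edge_class E i = edge_class E j \<longleftrightarrow> (i, j) \<in> (E \<union> E\<inverse>)\<^sup>*"
proof -
  have "sym (E \<union> E\<inverse>)" by (auto simp: sym_def)
  then have "equiv UNIV ((E \<union> E\<inverse>)\<^sup>*)"
    by (auto intro!: equivI refl_rtrancl sym_rtrancl trans_rtrancl)
  then show ?thesis
    unfolding edge_class_def by (rule eq_equiv_class_iff) auto
qed

lemma constant_along_edges_iff:
  assumes "E \<subseteq> S \<times> S"
  shows "(\<forall>(i, j)\<in>E. f i = f j) \<longleftrightarrow> constant_on_fibres S (edge_class E) f"
proof
  assume const: "\<forall>(i, j)\<in>E. f i = f j"
  have "f i = f j" if "(i, j) \<in> (E \<union> E\<inverse>)\<^sup>*" for i j
    using that by induction (use const in auto)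
  then show "constant_on_fibres S (edge_class E) f"
    by (simp add: constant_on_fibres_def edge_class_eq_iff)
next
  assume const: "constant_on_fibres S (edge_class E) f"
  show "\<forall>(i, j)\<in>E. f i = f j"
  proof clarify
    fix i j assume ij: "(i, j) \<in> E"
    then have "edge_class E i = edge_class E j"
      by (auto simp: edge_class_eq_iff)
    then show "f i = f j"
      using const ij assms by (auto simp: constant_on_fibres_def)
  qed
qed

definition increasing_along :: "('a \<times> 'a) set \<Rightarrow> ('a \<Rightarrow> 'b::preorder) \<Rightarrow> bool" where
  "increasing_along E f \<longleftrightarrow> (\<forall>(i, j)\<in>E. f i \<le> f j)"

lemma increasing_along_rtrancl: "increasing_along (E\<^sup>*) f \<longleftrightarrow> increasing_along E f"
proof
  assume incr: "increasing_along E f"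
  have "f i \<le> f j" if "(i, j) \<in> E\<^sup>*" for i j
    using that by induction (use incr in \<open>auto simp: increasing_along_def intro: order_trans\<close>)
  then show "increasing_along (E\<^sup>*) f"
    by (auto simp: increasing_along_def)
next
  assume "increasing_along (E\<^sup>*) f"
  then show "increasing_along E f"
    unfolding increasing_along_def using r_into_rtrancl by blast
qed

definition predecessor_count :: "('a \<times> 'a) set \<Rightarrow> 'a set \<Rightarrow> 'a \<Rightarrow> nat" where
  "predecessor_count R S i = card {k \<in> S. (k, i) \<in> R}"

lemma predecessor_count_le_iff:
  assumes "finite S" "refl R" "trans R"
    and total: "\<And>i j. i \<in> S \<Longrightarrow> j \<in> S \<Longrightarrow> (i, j) \<in> R \<or> (j, i) \<in> R"
    and ij: "i \<in> S" "j \<in> S"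
  shows "predecessor_count R S i \<le> predecessor_count R S j \<longleftrightarrow> (i, j) \<in> R"
proof
  assume "(i, j) \<in> R"
  then show "predecessor_count R S i \<le> predecessor_count R S j"
    unfolding predecessor_count_def
    using assms(1) transD[OF assms(3)] by (intro card_mono) auto
next
  assume le: "predecessor_count R S i \<le> predecessor_count R S j"
  show "(i, j) \<in> R"
  proof (rule ccontr)
    assume "(i, j) \<notin> R"
    then have "(j, i) \<in> R"
      using total ij by blast
    then have "{k \<in> S. (k, j) \<in> R} \<subset> {k \<in> S. (k, i) \<in> R}"
      using \<open>(i, j) \<notin> R\<close> ij(1) refl_onD[OF assms(2), of i] transD[OF assms(3)] by blast
    then have "predecessor_count R S j < predecessor_count R S i"
      unfolding predecessor_count_def using assms(1) by (intro psubset_card_mono) auto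
    then show False
      using le by simp
  qed
qed

section \<open>Chambers of an affine arrangement\<close>

definition generic_points ::
    "('e \<Rightarrow> 'v \<Rightarrow> real) \<Rightarrow> ('e \<Rightarrow> real) \<Rightarrow> 'e set \<Rightarrow> 'v set \<Rightarrow> 'v set" where
  "generic_points L c I V = {x \<in> V. \<forall>e\<in>I. L e x \<noteq> c e}"

definition positive_set :: "('e \<Rightarrow> 'v \<Rightarrow> real) \<Rightarrow> ('e \<Rightarrow> real) \<Rightarrow> 'e set \<Rightarrow> 'v \<Rightarrow> 'e set" where
  "positive_set L c I x = {e \<in> I. c e < L e x}"

definition chambers :: "('e \<Rightarrow> 'v \<Rightarrow> real) \<Rightarrow> ('e \<Rightarrow> real) \<Rightarrow> 'e set \<Rightarrow> 'v set \<Rightarrow> 'e set set" where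
  "chambers L c I V = positive_set L c I ` generic_points L c I V"

definition chamber_cell ::
    "('e \<Rightarrow> 'v \<Rightarrow> real) \<Rightarrow> ('e \<Rightarrow> real) \<Rightarrow> 'e set \<Rightarrow> 'v set \<Rightarrow> 'e set \<Rightarrow> 'v set" where
  "chamber_cell L c I V T = {x \<in> generic_points L c I V. positive_set L c I x = T}"

lemma in_chambers_iff_cell_nonempty: "T \<in> chambers L c I V \<longleftrightarrow> chamber_cell L c I V T \<noteq> {}"
  by (auto simp: chambers_def chamber_cell_def)

lemma chamber_cell_iff:
  "x \<in> chamber_cell L c I V T \<longleftrightarrow>
    x \<in> V \<and> T \<subseteq> I \<and> (\<forall>e\<in>I. if e \<in> T then c e < L e x else L e x < c e)"
  by (auto simp: chamber_cell_def generic_points_def positive_set_def neq_iff)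

lemma chamber_cell_Int: "chamber_cell L c I (V \<inter> W) T = chamber_cell L c I V T \<inter> W"
  by (auto simp: chamber_cell_iff)

lemma chambers_subset_Pow: "chambers L c I V \<subseteq> Pow I"
  by (auto simp: chambers_def positive_set_def)

lemma finite_chambers: "finite I \<Longrightarrow> finite (chambers L c I V)"
  by (rule finite_subset[OF chambers_subset_Pow]) simp

lemma chambers_restrict:
  assumes "T \<in> chambers L c I V" "J \<subseteq> I"
  shows "T \<inter> J \<in> chambers L c J V"
  using assms unfolding in_chambers_iff_cell_nonempty by (fastforce simp: chamber_cell_iff)

lemma chambers_Un: "chambers L c I (U \<union> V) = chambers L c I U \<union> chambers L c I V"
  by (auto simp: chambers_def generic_points_def)

lemma inj_on_chamber_cell: "inj_on (chamber_cell L c I V) (chambers L c I V)"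
  by (rule inj_onI) (auto simp: chambers_def chamber_cell_def)

lemma convex_chamber_cell:
  fixes L :: "'e \<Rightarrow> 'v::real_vector \<Rightarrow> real"
  assumes "convex V" and lin: "\<And>e. e \<in> I \<Longrightarrow> linear (L e)"
  shows "convex (chamber_cell L c I V T)"
proof (cases "T \<subseteq> I")
  case True
  then have "chamber_cell L c I V T =
      V \<inter> (\<Inter>e\<in>T. L e -` {c e<..}) \<inter> (\<Inter>e\<in>I - T. L e -` {..<c e})"
    by (auto simp: chamber_cell_iff)
  also have "convex \<dots>"
    using True by (intro convex_Int convex_INT convex_linear_vimage lin assms) auto
  finally show ?thesis .
next
  case False
  then have "chamber_cell L c I V T = {}"
    by (auto simp: chamber_cell_iff)
  then show ?thesis
    by simp
qed

lemma chambers_Int_sides_subset_hyperplane: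
  fixes L :: "'e \<Rightarrow> 'v::real_vector \<Rightarrow> real" and l :: "'v \<Rightarrow> real"
  assumes V: "convex V" and lin: "\<And>e. e \<in> I \<Longrightarrow> linear (L e)" and l: "linear l"
  shows "chambers L c I (V \<inter> {x. l x < d}) \<inter> chambers L c I (V \<inter> {x. d < l x})
    \<subseteq> chambers L c I (V \<inter> {x. l x = d})"
proof
  fix T assume "T \<in> chambers L c I (V \<inter> {x. l x < d}) \<inter> chambers L c I (V \<inter> {x. d < l x})"
  then obtain u w where u: "u \<in> chamber_cell L c I V T" "l u < d"
    and w: "w \<in> chamber_cell L c I V T" "d < l w"
    unfolding Int_iff in_chambers_iff_cell_nonempty chamber_cell_Int by blast
  define s where "s = (d - l u) / (l w - l u)"
  define z where "z = (1 - s) *\<^sub>R u + s *\<^sub>R w"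
  have "z \<in> chamber_cell L c I V T"
    unfolding z_def using u w
    by (intro convexD_alt convex_chamber_cell V lin) (auto simp: s_def field_simps)
  moreover have "l z = l u + s * (l w - l u)"
    unfolding z_def linear_add[OF l] linear_scale[OF l] by (simp add: algebra_simps)
  then have "l z = d"
    using u(2) w(2) by (simp add: s_def)
  ultimately show "T \<in> chambers L c I (V \<inter> {x. l x = d})"
    unfolding in_chambers_iff_cell_nonempty chamber_cell_Int by blast
qed

lemma eventually_in_chamber_cell:
  fixes L :: "'e \<Rightarrow> 'v::real_vector \<Rightarrow> real"
  assumes "finite I" and lin: "\<And>e. e \<in> I \<Longrightarrow> linear (L e)"
    and x: "x \<in> chamber_cell L c I UNIV T"
  shows "\<forall>\<^sub>F s in nhds 0. x + s *\<^sub>R v \<in> chamber_cell L c I UNIV T"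
proof -
  have "\<forall>\<^sub>F s in nhds 0. if e \<in> T then c e < L e (x + s *\<^sub>R v) else L e (x + s *\<^sub>R v) < c e"
    if e: "e \<in> I" for e
  proof -
    have "((\<lambda>s. L e x + s * L e v) \<longlongrightarrow> L e x + 0 * L e v) (nhds 0)"
      by (intro tendsto_intros filterlim_ident)
    then have lim: "((\<lambda>s. L e (x + s *\<^sub>R v)) \<longlongrightarrow> L e x) (nhds 0)"
      using lin[OF e] by (simp add: linear_add linear_scale)
    have "if e \<in> T then c e < L e x else L e x < c e"
      using x e by (simp add: chamber_cell_iff)
    then show ?thesis
      using order_tendstoD[OF lim, of "c e"] by (simp split: if_splits)
  qed
  then show ?thesis
    using assms(1) x by (simp add: chamber_cell_iff eventually_ball_finite)
qed

lemma chambers_hyperplane_subset_lower_side: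
  fixes L :: "'e \<Rightarrow> 'v::real_vector \<Rightarrow> real" and l :: "'v \<Rightarrow> real"
  assumes "finite I" "affine V" and lin: "\<And>e. e \<in> I \<Longrightarrow> linear (L e)" and l: "linear l"
    and y: "y \<in> V" "l y \<noteq> d"
  shows "chambers L c I (V \<inter> {x. l x = d}) \<subseteq> chambers L c I (V \<inter> {x. l x < d})"
proof
  fix T assume "T \<in> chambers L c I (V \<inter> {x. l x = d})"
  then obtain x where "x \<in> chamber_cell L c I V T" and lx: "l x = d"
    unfolding in_chambers_iff_cell_nonempty chamber_cell_Int by blast
  then have x: "x \<in> chamber_cell L c I UNIV T" "x \<in> V"
    by (simp_all add: chamber_cell_iff)
  define v where "v = (if l y < d then y - x else x - y)"
  have "\<forall>\<^sub>F s in at_right 0. x + s *\<^sub>R v \<in> chamber_cell L c I UNIV T"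
    using eventually_in_chamber_cell[OF assms(1) lin x(1), of v]
    by (auto simp: eventually_nhds_conv_at eventually_at_split)
  then have "\<forall>\<^sub>F s in at_right 0. 0 < s \<and> x + s *\<^sub>R v \<in> chamber_cell L c I UNIV T"
    using eventually_at_right_less by (rule eventually_conj[rotated])
  then obtain s :: real where s: "0 < s" "x + s *\<^sub>R v \<in> chamber_cell L c I UNIV T"
    using eventually_happens'[OF trivial_limit_at_right_real] by blast
  have "x + s *\<^sub>R v \<in> V"
    using mem_affine_3_minus[OF assms(2) x(2) y(1) x(2), of s]
      mem_affine_3_minus[OF assms(2) x(2) x(2) y(1), of s]
    by (simp add: v_def)
  moreover have "l v < 0"
    using lx y(2) by (auto simp: v_def linear_diff[OF l])
  then have "l (x + s *\<^sub>R v) < d"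
    using s(1) lx by (simp add: linear_add[OF l] linear_scale[OF l] mult_pos_neg)
  ultimately have "x + s *\<^sub>R v \<in> chamber_cell L c I (V \<inter> {x. l x < d}) T"
    using s(2) by (simp add: chamber_cell_iff)
  then show "T \<in> chambers L c I (V \<inter> {x. l x < d})"
    unfolding in_chambers_iff_cell_nonempty by blast
qed

lemma chambers_hyperplane_subset_upper_side:
  fixes L :: "'e \<Rightarrow> 'v::real_vector \<Rightarrow> real" and l :: "'v \<Rightarrow> real"
  assumes "finite I" "affine V" "\<And>e. e \<in> I \<Longrightarrow> linear (L e)" "linear l" "y \<in> V" "l y \<noteq> d"
  shows "chambers L c I (V \<inter> {x. l x = d}) \<subseteq> chambers L c I (V \<inter> {x. d < l x})"
proof -
  have "chambers L c I (V \<inter> {x. - l x = - d}) \<subseteq> chambers L c I (V \<inter> {x. - l x < - d})"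
    by (rule chambers_hyperplane_subset_lower_side) (use assms in \<open>auto intro: linear_compose_neg\<close>)
  then show ?thesis
    by (simp only: neg_equal_iff_equal neg_less_iff_less)
qed

lemma inj_on_insert_Pow: "e \<notin> I \<Longrightarrow> inj_on (insert e) (Pow I)"
  by (intro inj_onI) (metis PowD insert_ident subsetD)

lemma chambers_insert:
  assumes "e \<notin> I"
  shows "chambers L c (insert e I) V = chambers L c I (V \<inter> {x. L e x < c e})
    \<union> insert e ` chambers L c I (V \<inter> {x. c e < L e x})"
proof -
  have "generic_points L c (insert e I) V
      = generic_points L c I (V \<inter> {x. L e x < c e}) \<union> generic_points L c I (V \<inter> {x. c e < L e x})"
    by (auto simp: generic_points_def)
  moreover have "positive_set L c (insert e I) ` generic_points L c I (V \<inter> {x. L e x < c e})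
      = chambers L c I (V \<inter> {x. L e x < c e})"
    unfolding chambers_def by (rule image_cong) (auto simp: positive_set_def generic_points_def)
  moreover have "positive_set L c (insert e I) ` generic_points L c I (V \<inter> {x. c e < L e x})
      = insert e ` chambers L c I (V \<inter> {x. c e < L e x})"
    unfolding chambers_def image_image
    by (rule image_cong) (auto simp: positive_set_def generic_points_def)
  ultimately show ?thesis
    unfolding chambers_def[of L c "insert e I"] by (simp add: image_Un)
qed

lemma chambers_Int_sides:
  fixes L :: "'e \<Rightarrow> 'v::real_vector \<Rightarrow> real" and l :: "'v \<Rightarrow> real"
  assumes "finite I" "affine V" "\<And>e. e \<in> I \<Longrightarrow> linear (L e)" "linear l" "y \<in> V" "l y \<noteq> d"
  shows "chambers L c I (V \<inter> {x. l x < d}) \<inter> chambers L c I (V \<inter> {x. d < l x})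
    = chambers L c I (V \<inter> {x. l x = d})"
proof (intro subset_antisym Int_greatest)
  show "chambers L c I (V \<inter> {x. l x < d}) \<inter> chambers L c I (V \<inter> {x. d < l x})
      \<subseteq> chambers L c I (V \<inter> {x. l x = d})"
    by (intro chambers_Int_sides_subset_hyperplane affine_imp_convex assms)
  show "chambers L c I (V \<inter> {x. l x = d}) \<subseteq> chambers L c I (V \<inter> {x. l x < d})"
    using assms by (rule chambers_hyperplane_subset_lower_side)
  show "chambers L c I (V \<inter> {x. l x = d}) \<subseteq> chambers L c I (V \<inter> {x. d < l x})"
    using assms by (rule chambers_hyperplane_subset_upper_side)
qed

lemma chambers_Un_sides:
  fixes L :: "'e \<Rightarrow> 'v::real_vector \<Rightarrow> real" and l :: "'v \<Rightarrow> real"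
  assumes "finite I" "affine V" "\<And>e. e \<in> I \<Longrightarrow> linear (L e)" "linear l" "y \<in> V" "l y \<noteq> d"
  shows "chambers L c I (V \<inter> {x. l x < d}) \<union> chambers L c I (V \<inter> {x. d < l x}) = chambers L c I V"
proof -
  have "V = V \<inter> {x. l x < d} \<union> V \<inter> {x. d < l x} \<union> V \<inter> {x. l x = d}"
    by auto
  then have "chambers L c I V = chambers L c I (V \<inter> {x. l x < d})
      \<union> chambers L c I (V \<inter> {x. d < l x}) \<union> chambers L c I (V \<inter> {x. l x = d})"
    by (metis chambers_Un)
  moreover have "chambers L c I (V \<inter> {x. l x = d}) \<subseteq> chambers L c I (V \<inter> {x. l x < d})"
    using assms by (rule chambers_hyperplane_subset_lower_side)
  ultimately show ?thesis
    by blast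
qed

lemma card_chambers_insert:
  fixes L :: "'e \<Rightarrow> 'v::real_vector \<Rightarrow> real"
  assumes fin: "finite I" and e: "e \<notin> I" and V: "affine V"
    and lin: "\<And>e'. e' \<in> insert e I \<Longrightarrow> linear (L e')"
    and y: "y \<in> V" "L e y \<noteq> c e"
  shows "card (chambers L c (insert e I) V) =
    card (chambers L c I V) + card (chambers L c I (V \<inter> {x. L e x = c e}))"
proof -
  let ?M = "chambers L c I (V \<inter> {x. L e x < c e})"
  let ?P = "chambers L c I (V \<inter> {x. c e < L e x})"
  have sub: "?M \<subseteq> Pow I" "?P \<subseteq> Pow I"
    by (simp_all add: chambers_subset_Pow)
  have finite: "finite ?M" "finite ?P"
    using fin by (simp_all add: finite_chambers)
  have "?M \<inter> insert e ` ?P = {}" "inj_on (insert e) ?P"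
    using sub e inj_on_subset[OF inj_on_insert_Pow[OF e]] by auto
  then have "card (chambers L c (insert e I) V) = card ?M + card ?P"
    using finite by (simp add: chambers_insert[OF e] card_Un_disjoint card_image)
  also have "\<dots> = card (?M \<union> ?P) + card (?M \<inter> ?P)"
    by (rule card_Un_Int[OF finite])
  also have "?M \<union> ?P = chambers L c I V"
    by (rule chambers_Un_sides) (use fin V lin y in auto)
  also have "?M \<inter> ?P = chambers L c I (V \<inter> {x. L e x = c e})"
    by (rule chambers_Int_sides) (use fin V lin y in auto)
  finally show ?thesis .
qed

section \<open>Zaslavsky's theorem\<close>

definition signed_flat :: "(nat \<Rightarrow> real) set \<Rightarrow> real" where
  "signed_flat F = (if F = {} then 0 else (-1) ^ affine_dim F)"

lemma signed_flat_hyperplane_section: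
  fixes L :: "(nat \<Rightarrow> real) \<Rightarrow> real"
  assumes "finite S" "affine V" "V \<subseteq> span S" "linear L" "y \<in> V" "L y \<noteq> c"
    and "V \<inter> {x. L x = c} \<noteq> {}"
  shows "signed_flat (V \<inter> {x. L x = c}) = - signed_flat V"
proof -
  obtain x where "x \<in> V" "L x = c"
    using assms(7) by blast
  then have "affine_dim V = Suc (affine_dim (V \<inter> {x. L x = c}))"
    using affine_dim_hyperplane_section[OF assms(1-4)] assms(5,6) by blast
  then show ?thesis
    using assms(5,7) by (auto simp: signed_flat_def)
qed

definition alternating_flat_sum ::
    "('e \<Rightarrow> (nat \<Rightarrow> real) \<Rightarrow> real) \<Rightarrow> ('e \<Rightarrow> real) \<Rightarrow> 'e set \<Rightarrow> (nat \<Rightarrow> real) set \<Rightarrow> real" where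
  "alternating_flat_sum L c I V =
    (\<Sum>B\<in>Pow I. (-1) ^ card B * signed_flat (V \<inter> {x. \<forall>e\<in>B. L e x = c e}))"

lemma alternating_flat_sum_insert:
  assumes "finite I" "e \<notin> I"
  shows "alternating_flat_sum L c (insert e I) V =
    alternating_flat_sum L c I V - alternating_flat_sum L c I (V \<inter> {x. L e x = c e})"
proof -
  let ?w = "\<lambda>V B. (-1) ^ card B * signed_flat (V \<inter> {x. \<forall>e\<in>B. L e x = c e})"
  have "?w V (insert e B) = - ?w (V \<inter> {x. L e x = c e}) B" if "B \<in> Pow I" for B
  proof -
    have "card (insert e B) = Suc (card B)"
      using that assms by (auto intro: card_insert_disjoint finite_subset)
    moreover have "V \<inter> {x. \<forall>e\<in>insert e B. L e x = c e}
        = (V \<inter> {x. L e x = c e}) \<inter> {x. \<forall>e\<in>B. L e x = c e}"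
      by auto
    ultimately show ?thesis
      by simp
  qed
  then have "(\<Sum>B\<in>insert e ` Pow I. ?w V B) = - alternating_flat_sum L c I (V \<inter> {x. L e x = c e})"
    unfolding alternating_flat_sum_def sum_negf[symmetric]
    using inj_on_insert_Pow[OF assms(2)] by (simp add: sum.reindex)
  moreover have "(\<Sum>B\<in>Pow (insert e I). ?w V B)
      = (\<Sum>B\<in>Pow I. ?w V B) + (\<Sum>B\<in>insert e ` Pow I. ?w V B)"
    unfolding Pow_insert using assms by (intro sum.union_disjoint) auto
  ultimately show ?thesis
    by (simp add: alternating_flat_sum_def)
qed

definition signed_chamber_count ::
    "('e \<Rightarrow> (nat \<Rightarrow> real) \<Rightarrow> real) \<Rightarrow> ('e \<Rightarrow> real) \<Rightarrow> 'e set \<Rightarrow> (nat \<Rightarrow> real) set \<Rightarrow> real" where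
  "signed_chamber_count L c I V = signed_flat V * real (card (chambers L c I V))"

lemma signed_chamber_count_insert:
  assumes "finite I" "e \<notin> I" and V: "finite S" "affine V" "V \<subseteq> span S"
    and lin: "\<And>e'. e' \<in> insert e I \<Longrightarrow> linear (L e')"
  shows "signed_chamber_count L c (insert e I) V =
    signed_chamber_count L c I V - signed_chamber_count L c I (V \<inter> {x. L e x = c e})"
proof (cases "V \<subseteq> {x. L e x = c e}")
  case True
  then have "V \<inter> {x. L e x = c e} = V" "chambers L c (insert e I) V = {}"
    by (auto simp: chambers_def generic_points_def)
  then show ?thesis
    by (simp add: signed_chamber_count_def)
next
  case False
  then obtain y where y: "y \<in> V" "L e y \<noteq> c e"
    by auto
  let ?H = "V \<inter> {x. L e x = c e}"
  have "signed_flat ?H * real (card (chambers L c I ?H))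
      = - signed_flat V * real (card (chambers L c I ?H))"
  proof (cases "?H = {}")
    case False
    then show ?thesis
      using signed_flat_hyperplane_section[OF V lin y] by simp
  qed (simp add: chambers_def generic_points_def)
  then show ?thesis
    using card_chambers_insert[where L = L and c = c, OF assms(1,2) V(2) lin y]
    by (simp add: signed_chamber_count_def algebra_simps)
qed

lemma zaslavsky:
  assumes "finite I" "finite S" "affine V" "V \<subseteq> span S" "\<And>e. e \<in> I \<Longrightarrow> linear (L e)"
  shows "alternating_flat_sum L c I V = signed_chamber_count L c I V"
  using assms(1,3-)
proof (induction I arbitrary: V rule: finite_induct)
  case empty
  have "chambers L c {} V = (if V = {} then {} else {{}})"
    by (auto simp: chambers_def generic_points_def positive_set_def)
  then show ?case
    by (simp add: alternating_flat_sum_def signed_chamber_count_def signed_flat_def)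
next
  case (insert e I)
  let ?H = "V \<inter> {x. L e x = c e}"
  have "alternating_flat_sum L c I V = signed_chamber_count L c I V"
    using insert.prems by (intro insert.IH) auto
  moreover have "alternating_flat_sum L c I ?H = signed_chamber_count L c I ?H"
    using insert.prems by (intro insert.IH affine_level_set) auto
  moreover have "signed_chamber_count L c (insert e I) V
      = signed_chamber_count L c I V - signed_chamber_count L c I ?H"
    by (rule signed_chamber_count_insert[OF insert.hyps assms(2) insert.prems])
  ultimately show ?case
    by (simp only: alternating_flat_sum_insert[OF insert.hyps])
qed

section \<open>Regions are chambers\<close>

lemma convex_connected_fun:
  fixes C :: "('i \<Rightarrow> real) set"
  assumes "convex C"
  shows "connected C"
proof -
  have "\<exists>T. connected T \<and> T \<subseteq> C \<and> x \<in> T \<and> y \<in> T" if "x \<in> C" "y \<in> C" for x y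
  proof (intro exI conjI)
    have "continuous_on {0..1::real} (\<lambda>s. (1 - s) *\<^sub>R x + s *\<^sub>R y)"
      by (rule continuous_on_coordinatewise_then_product)
        (auto simp: scaleR_fun_def intro!: continuous_intros)
    then show "connected (closed_segment x y)"
      unfolding closed_segment_image_interval
      by (rule connected_continuous_image) simp
    show "closed_segment x y \<subseteq> C"
      using assms that by (simp add: closed_segment_subset)
  qed auto
  then show ?thesis
    by (simp add: connected_iff_connected_component[of C] connected_component_def)
qed

lemma connectedin_Euclidean_space:
  "connectedin (Euclidean_space n) C \<longleftrightarrow> C \<subseteq> topspace (Euclidean_space n) \<and> connected C"
  by (auto simp: Euclidean_space_def connectedin_subtopology euclidean_product_topology)

lemma positive_set_eq_on_connected:
  fixes L :: "'e \<Rightarrow> (nat \<Rightarrow> real) \<Rightarrow> real"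
  assumes cont: "\<And>e. e \<in> I \<Longrightarrow> continuous_on UNIV (L e)"
    and C: "connected C" "C \<subseteq> generic_points L c I V" and xy: "x \<in> C" "y \<in> C"
  shows "positive_set L c I x = positive_set L c I y"
proof -
  have "c e < L e x \<longleftrightarrow> c e < L e y" if e: "e \<in> I" for e
  proof (rule ccontr)
    assume "\<not> ?thesis"
    then have "L e x \<le> c e \<and> c e \<le> L e y \<or> L e y \<le> c e \<and> c e \<le> L e x"
      by linarith
    moreover have "connected (L e ` C)"
      using connected_continuous_image[OF continuous_on_subset[OF cont[OF e]] C(1)] by simp
    ultimately have "c e \<in> L e ` C"
      using connectedD_interval[of "L e ` C"] xy by blast
    then obtain z where "z \<in> C" "L e z = c e"
      by auto
    then show False
      using C(2) e by (auto simp: generic_points_def)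
  qed
  then show ?thesis
    by (auto simp: positive_set_def)
qed

lemma connected_component_eq_chamber_cell:
  fixes L :: "'e \<Rightarrow> (nat \<Rightarrow> real) \<Rightarrow> real" and c :: "'e \<Rightarrow> real" and I :: "'e set" and n :: nat
  defines "G \<equiv> generic_points L c I (topspace (Euclidean_space n))"
  assumes lin: "\<And>e. e \<in> I \<Longrightarrow> linear (L e)"
    and cont: "\<And>e. e \<in> I \<Longrightarrow> continuous_on UNIV (L e)"
    and x: "x \<in> G"
  shows "connected_component_of_set (subtopology (Euclidean_space n) G) x =
    chamber_cell L c I (topspace (Euclidean_space n)) (positive_set L c I x)"
    (is "?component = ?cell")
proof (rule subset_antisym)
  have conn: "connectedin (subtopology (Euclidean_space n) G) C \<longleftrightarrow> C \<subseteq> G \<and> connected C" for C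
    by (auto simp: G_def generic_points_def connectedin_subtopology connectedin_Euclidean_space)
  have "convex ?cell"
    by (intro convex_chamber_cell lin subspace_imp_convex subspace_Euclidean_space)
  then have "connectedin (subtopology (Euclidean_space n) G) ?cell"
    unfolding conn by (auto simp: G_def chamber_cell_def intro: convex_connected_fun)
  then show "?cell \<subseteq> ?component"
    using x by (intro connected_component_of_maximal) (auto simp: G_def chamber_cell_def)
  have component: "connected ?component" "?component \<subseteq> G"
    using connectedin_connected_component_of[of "subtopology (Euclidean_space n) G" x]
    unfolding conn by auto
  have "x \<in> ?component"
    using x by (simp add: connected_component_of_refl G_def generic_points_def)
  have "positive_set L c I y = positive_set L c I x" if "y \<in> ?component" for y
    using cont component that \<open>x \<in> ?component\<close> unfolding G_def
    by (rule positive_set_eq_on_connected)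
  then show "?component \<subseteq> ?cell"
    using component(2) unfolding G_def chamber_cell_def by blast
qed

lemma regions_eq_chamber_cells:
  fixes L :: "'e \<Rightarrow> (nat \<Rightarrow> real) \<Rightarrow> real" and n :: nat
  defines "E \<equiv> topspace (Euclidean_space n)"
  assumes "\<And>e. e \<in> I \<Longrightarrow> linear (L e)" "\<And>e. e \<in> I \<Longrightarrow> continuous_on UNIV (L e)"
  shows "regions n ((\<lambda>e. {x \<in> E. L e x = c e}) ` I) = chamber_cell L c I E ` chambers L c I E"
proof -
  define G where "G = generic_points L c I E"
  let ?X = "subtopology (Euclidean_space n) (- \<Union> ((\<lambda>e. {x \<in> E. L e x = c e}) ` I))"
  have generic: "topspace (Euclidean_space n) \<inter> - \<Union> ((\<lambda>e. {x \<in> E. L e x = c e}) ` I) = G"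
    by (auto simp: G_def E_def generic_points_def)
  have "?X = subtopology (Euclidean_space n) G"
    by (simp only: generic[symmetric] subtopology_restrict)
  moreover have "topspace ?X = G"
    by (simp only: topspace_subtopology generic)
  ultimately have "regions n ((\<lambda>e. {x \<in> E. L e x = c e}) ` I)
      = connected_component_of_set (subtopology (Euclidean_space n) G) ` G"
    by (simp only: regions_def connected_components_of_def)
  also have "\<dots> = (\<lambda>x. chamber_cell L c I E (positive_set L c I x)) ` G"
    unfolding G_def E_def
    by (intro image_cong connected_component_eq_chamber_cell assms(2,3) refl)
  finally show ?thesis
    by (simp add: chambers_def image_image G_def)
qed

section \<open>Tubes and levels\<close>

definition tube :: "nat \<Rightarrow> (nat \<Rightarrow> real) set \<Rightarrow> real \<Rightarrow> (nat \<Rightarrow> real) set" where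
  "tube n W r = {x \<in> topspace (Euclidean_space n). (INF w\<in>W. euclid_dist n x w) \<le> r}"

lemma tubeI:
  assumes "x \<in> topspace (Euclidean_space n)" "w \<in> W" "euclid_dist n x w \<le> r"
  shows "x \<in> tube n W r"
proof -
  have "bdd_below (euclid_dist n x ` W)"
    by (rule bdd_belowI[of _ 0]) (auto simp: euclid_dist_def L2_set_nonneg)
  then have "(INF w\<in>W. euclid_dist n x w) \<le> r"
    using cINF_lower[of _ W] assms(2,3) by (meson order_trans)
  then show ?thesis
    using assms(1) by (simp add: tube_def)
qed

lemma tube_nearby_point:
  assumes "x \<in> tube n W r" "W \<noteq> {}" "r < r'"
  obtains w where "w \<in> W" "euclid_dist n x w < r'"
  using assms cInf_lessD[of "euclid_dist n x ` W" r'] by (auto simp: tube_def)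

lemma abs_linear_form_le:
  fixes \<phi> :: "(nat \<Rightarrow> real) \<Rightarrow> real"
  assumes "linear \<phi>" "z \<in> topspace (Euclidean_space n)"
  shows "\<bar>\<phi> z\<bar> \<le> L2_set (\<lambda>i. \<phi> (fibre_indicator n id i)) {..<n} * L2_set z {..<n}"
proof -
  have "z = (\<Sum>i<n. z i *\<^sub>R fibre_indicator n id i)"
    using assms(2) fibre_indicator_sum_apply[of z n id]
    by (auto simp: fun_eq_iff topspace_Euclidean_space)
  then have "\<phi> z = \<phi> (\<Sum>i<n. z i *\<^sub>R fibre_indicator n id i)"
    by (rule arg_cong)
  also have "\<dots> = (\<Sum>i<n. z i * \<phi> (fibre_indicator n id i))"
    using assms(1) by (simp add: linear_sum linear_scale)
  also have "\<bar>\<dots>\<bar> \<le> (\<Sum>i<n. \<bar>\<phi> (fibre_indicator n id i)\<bar> * \<bar>z i\<bar>)"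
    by (rule order_trans[OF sum_abs]) (simp add: abs_mult mult.commute)
  also have "\<dots> \<le> L2_set (\<lambda>i. \<phi> (fibre_indicator n id i)) {..<n} * L2_set z {..<n}"
    by (rule L2_set_mult_ineq)
  finally show ?thesis .
qed

lemma linear_form_bounded_on_tube:
  fixes \<phi> :: "(nat \<Rightarrow> real) \<Rightarrow> real"
  assumes \<phi>: "linear \<phi>" and W: "W \<subseteq> topspace (Euclidean_space n)" "W \<noteq> {}"
    and vanish: "\<And>w. w \<in> W \<Longrightarrow> \<phi> w = 0"
  obtains C where "\<And>x. x \<in> tube n W r \<Longrightarrow> \<bar>\<phi> x\<bar> \<le> C"
proof
  let ?N = "L2_set (\<lambda>i. \<phi> (fibre_indicator n id i)) {..<n}"
  fix x assume x: "x \<in> tube n W r"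
  then obtain w where w: "w \<in> W" "euclid_dist n x w < r + 1"
    using W(2) by (rule tube_nearby_point[where r' = "r + 1"]) simp_all
  have "x - w \<in> topspace (Euclidean_space n)"
    using x w(1) W(1) by (intro subspace_diff subspace_Euclidean_space) (auto simp: tube_def)
  then have "\<bar>\<phi> (x - w)\<bar> \<le> ?N * euclid_dist n x w"
    using abs_linear_form_le[OF \<phi>] by (simp add: euclid_dist_def fun_diff_def)
  also have "\<dots> \<le> ?N * (r + 1)"
    using w(2) by (intro mult_left_mono) (auto simp: L2_set_nonneg)
  finally show "\<bar>\<phi> x\<bar> \<le> ?N * (r + 1)"
    using \<phi> vanish[OF w(1)] by (simp add: linear_diff)
qed

lemma linear_form_separating_subspace:
  fixes W :: "'v::real_vector set"
  assumes W: "subspace W" and "v \<notin> W"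
  obtains \<phi> :: "'v \<Rightarrow> real" where "linear \<phi>" "\<phi> v = 1" "\<And>w. w \<in> W \<Longrightarrow> \<phi> w = 0"
proof -
  obtain B where B: "B \<subseteq> W" "independent B" "W \<subseteq> span B"
    by (rule maximal_independent_subset)
  have spanB: "span B = W"
    using span_minimal[OF B(1) W] B(3) by (rule subset_antisym)
  then have "independent (insert v B)"
    using \<open>v \<notin> W\<close> B(2) by (simp add: independent_insertI)
  then obtain \<phi> :: "'v \<Rightarrow> real" where
    \<phi>: "linear \<phi>" "\<forall>x\<in>insert v B. \<phi> x = (if x = v then 1 else 0)"
    using linear_independent_extend[of "insert v B" "\<lambda>x. if x = v then 1 else 0"] by blast
  have "\<phi> b = 0" if "b \<in> B" for b
    using \<phi>(2) that \<open>v \<notin> W\<close> B(1) by auto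
  then have "\<phi> w = 0" if "w \<in> W" for w
    using linear_eq_0_on_span[OF \<phi>(1)] that spanB by blast
  then show ?thesis
    using \<phi> by (intro that[of \<phi>]) auto
qed

text \<open>A linear form vanishing on \<open>W\<close> is bounded on a tube around \<open>W\<close>, hence vanishes at the
  direction of every ray inside the tube.\<close>

lemma ray_in_tube_imp_direction_in_subspace:
  assumes W: "subspace W" "W \<subseteq> topspace (Euclidean_space n)"
    and ray: "\<And>s. 0 \<le> s \<Longrightarrow> x + s *\<^sub>R v \<in> tube n W r"
  shows "v \<in> W"
proof (rule ccontr)
  assume "v \<notin> W"
  then obtain \<phi> :: "(nat \<Rightarrow> real) \<Rightarrow> real"
    where \<phi>: "linear \<phi>" "\<phi> v = 1" "\<And>w. w \<in> W \<Longrightarrow> \<phi> w = 0"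
    using linear_form_separating_subspace[OF W(1)] by blast
  have "W \<noteq> {}"
    using W(1) subspace_0 by blast
  then obtain C where C: "\<And>x. x \<in> tube n W r \<Longrightarrow> \<bar>\<phi> x\<bar> \<le> C"
    using linear_form_bounded_on_tube[OF \<phi>(1) W(2) _ \<phi>(3)] by blast
  define s where "s = \<bar>C\<bar> + \<bar>\<phi> x\<bar> + 1"
  have "\<bar>\<phi> (x + s *\<^sub>R v)\<bar> \<le> C"
    by (intro C ray) (simp add: s_def)
  moreover have "\<phi> (x + s *\<^sub>R v) = \<phi> x + s"
    using \<phi>(1,2) by (simp add: linear_add linear_scale)
  ultimately show False
    by (simp add: s_def)
qed

lemma level_eq_dim:
  assumes W: "subspace W" "W \<subseteq> topspace (Euclidean_space n)" "0 < r" "X \<subseteq> tube n W r"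
    and least: "\<And>W' r'. subspace W' \<Longrightarrow> W' \<subseteq> topspace (Euclidean_space n) \<Longrightarrow>
      X \<subseteq> tube n W' r' \<Longrightarrow> W \<subseteq> W'"
  shows "level n X = dim W"
  unfolding level_def tube_def[symmetric]
proof (rule Least_equality)
  show "\<exists>W' r. subspace W' \<and> W' \<subseteq> topspace (Euclidean_space n) \<and> dim W' = dim W \<and> r > 0
      \<and> X \<subseteq> tube n W' r"
    using W by blast
  fix l
  assume "\<exists>W' r. subspace W' \<and> W' \<subseteq> topspace (Euclidean_space n) \<and> dim W' = l \<and> r > 0
      \<and> X \<subseteq> tube n W' r"
  then obtain W' where "W \<subseteq> W'" "W' \<subseteq> topspace (Euclidean_space n)" "dim W' = l"
    using least by blast
  then show "dim W \<le> l"
    using Euclidean_space_finite_span[of n] dim_mono_finite_span by metis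
qed

section \<open>Chambers of a difference arrangement\<close>

definition diff_triples :: "nat \<Rightarrow> real set \<Rightarrow> (nat \<times> nat \<times> real) set" where
  "diff_triples n A = {(i, j, a). i < j \<and> j < n \<and> a \<in> A}"

fun diff_form :: "nat \<times> nat \<times> real \<Rightarrow> (nat \<Rightarrow> real) \<Rightarrow> real" where
  "diff_form (i, j, a) x = x i - x j"

fun diff_const :: "nat \<times> nat \<times> real \<Rightarrow> real" where
  "diff_const (i, j, a) = a"

abbreviation diff_chambers :: "nat \<Rightarrow> (nat \<times> nat \<times> real) set \<Rightarrow> (nat \<times> nat \<times> real) set set" where
  "diff_chambers n I \<equiv> chambers diff_form diff_const I (topspace (Euclidean_space n))"

abbreviation diff_cell ::
    "nat \<Rightarrow> (nat \<times> nat \<times> real) set \<Rightarrow> (nat \<times> nat \<times> real) set \<Rightarrow> (nat \<Rightarrow> real) set" where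
  "diff_cell n I \<equiv> chamber_cell diff_form diff_const I (topspace (Euclidean_space n))"

lemma diff_triples_iff [simp]: "(i, j, a) \<in> diff_triples n A \<longleftrightarrow> i < j \<and> j < n \<and> a \<in> A"
  by (simp add: diff_triples_def)

lemma finite_diff_triples: "finite A \<Longrightarrow> finite (diff_triples n A)"
  by (rule finite_subset[of _ "{..<n} \<times> {..<n} \<times> A"]) auto

lemma linear_diff_form: "linear (diff_form e)"
  by (cases e) (auto intro!: linearI simp: scaleR_fun_def algebra_simps)

lemma continuous_on_diff_form: "continuous_on UNIV (diff_form e)"
proof (cases e)
  case (fields i j a)
  have "continuous_on UNIV (\<lambda>x. x i - x j :: real)"
    by (intro continuous_intros continuous_on_product_coordinates)
  then show ?thesis
    by (simp add: fields)
qed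

lemma diff_cell_iff:
  "x \<in> diff_cell n I T \<longleftrightarrow> x \<in> topspace (Euclidean_space n) \<and> T \<subseteq> I \<and>
    (\<forall>(p, q, a)\<in>I. if (p, q, a) \<in> T then a < x p - x q else x p - x q < a)"
  by (auto simp: chamber_cell_iff split_paired_all)

lemma diff_cell_sign:
  assumes "x \<in> diff_cell n I T" "(p, q, a) \<in> I"
  shows "(p, q, a) \<in> T \<longleftrightarrow> a < x p - x q" "(p, q, a) \<notin> T \<longleftrightarrow> x p - x q < a"
proof -
  have "if (p, q, a) \<in> T then a < x p - x q else x p - x q < a"
    using assms unfolding diff_cell_iff by blast
  then show "(p, q, a) \<in> T \<longleftrightarrow> a < x p - x q" "(p, q, a) \<notin> T \<longleftrightarrow> x p - x q < a"
    by (auto split: if_splits)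
qed

lemma diff_chamber_downward_closed:
  assumes T: "T \<in> diff_chambers n (diff_triples n A)"
    and "(p, q, b) \<in> T" "a \<in> A" "a \<le> b"
  shows "(p, q, a) \<in> T"
proof -
  obtain x where x: "x \<in> diff_cell n (diff_triples n A) T"
    using T by (auto simp: in_chambers_iff_cell_nonempty)
  have "(p, q, b) \<in> diff_triples n A"
    using T assms(2) chambers_subset_Pow by blast
  then show ?thesis
    using assms(2-4) diff_cell_sign(1)[OF x, of p q] by simp
qed

text \<open>An edge \<open>p \<rightarrow> q\<close> records that \<open>x\<^sub>q - x\<^sub>p\<close> is bounded below on the region, so that
  \<open>v\<^sub>p \<le> v\<^sub>q\<close> for every direction \<open>v\<close> in which the region is unbounded.\<close>

definition forced_edges :: "nat \<Rightarrow> real set \<Rightarrow> (nat \<times> nat \<times> real) set \<Rightarrow> (nat \<times> nat) set" where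
  "forced_edges n A T = {(p, q). p < n \<and> q < n \<and>
    (p < q \<and> (p, q, Max A) \<notin> T \<or> q < p \<and> (q, p, Min A) \<in> T)}"

lemma forced_edge_of_notin_chamber:
  assumes A: "finite A" "A \<noteq> {}" and T: "T \<in> diff_chambers n (diff_triples n A)"
    and "(p, q, a) \<in> diff_triples n A" "(p, q, a) \<notin> T"
  shows "(p, q) \<in> forced_edges n A T"
proof -
  have "(p, q, Max A) \<notin> T"
    using diff_chamber_downward_closed[OF T, of p q "Max A" a] A assms(4,5) by auto
  then show ?thesis
    using assms(4) by (simp add: forced_edges_def)
qed

lemma forced_edge_of_in_chamber:
  assumes A: "finite A" "A \<noteq> {}" and T: "T \<in> diff_chambers n (diff_triples n A)"
    and "(p, q, a) \<in> diff_triples n A" "(p, q, a) \<in> T"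
  shows "(q, p) \<in> forced_edges n A T"
proof -
  have "(p, q, Min A) \<in> T"
    using diff_chamber_downward_closed[OF T assms(5)] A assms(4) by auto
  then show ?thesis
    using assms(4) by (simp add: forced_edges_def)
qed

lemma increasing_along_forced_edges_iff:
  fixes f :: "nat \<Rightarrow> 'b::linorder"
  assumes A: "finite A" "A \<noteq> {}" and T: "T \<in> diff_chambers n (diff_triples n A)"
  shows "increasing_along (forced_edges n A T) f \<longleftrightarrow>
    (\<forall>(p, q, a)\<in>diff_triples n A.
      (f p < f q \<longrightarrow> (p, q, a) \<notin> T) \<and> (f q < f p \<longrightarrow> (p, q, a) \<in> T))"
    (is "_ \<longleftrightarrow> ?sorted")
proof
  assume "increasing_along (forced_edges n A T) f"
  then have incr: "f p \<le> f q" if "(p, q) \<in> forced_edges n A T" for p q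
    using that by (auto simp: increasing_along_def)
  have "(f p < f q \<longrightarrow> (p, q, a) \<notin> T) \<and> (f q < f p \<longrightarrow> (p, q, a) \<in> T)"
    if "(p, q, a) \<in> diff_triples n A" for p q a
    using incr forced_edge_of_in_chamber[OF assms that] forced_edge_of_notin_chamber[OF assms that]
    by (meson leD)
  then show ?sorted
    by blast
next
  assume sorted: ?sorted
  have below: "(p, q, a) \<notin> T" if "p < q" "q < n" "a \<in> A" "f p < f q" for p q a
    using bspec[OF sorted, of "(p, q, a)"] that by simp
  have above: "(p, q, a) \<in> T" if "p < q" "q < n" "a \<in> A" "f q < f p" for p q a
    using bspec[OF sorted, of "(p, q, a)"] that by simp
  have "f p \<le> f q" if "(p, q) \<in> forced_edges n A T" for p q
    using that above[of p q "Max A"] below[of q p "Min A"] A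
    by (auto simp: forced_edges_def not_less[symmetric])
  then show "increasing_along (forced_edges n A T) f"
    by (auto simp: increasing_along_def)
qed

lemma diff_cell_ray:
  assumes A: "finite A" "A \<noteq> {}" and x: "x \<in> diff_cell n (diff_triples n A) T"
    and v: "v \<in> topspace (Euclidean_space n)" "increasing_along (forced_edges n A T) v"
    and s: "0 \<le> s"
  shows "x + s *\<^sub>R v \<in> diff_cell n (diff_triples n A) T"
proof -
  have T: "T \<in> diff_chambers n (diff_triples n A)"
    using x by (auto simp: in_chambers_iff_cell_nonempty)
  have "if (p, q, a) \<in> T then a < (x + s *\<^sub>R v) p - (x + s *\<^sub>R v) q
      else (x + s *\<^sub>R v) p - (x + s *\<^sub>R v) q < a" if e: "(p, q, a) \<in> diff_triples n A" for p q a
  proof -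
    have diff: "(x + s *\<^sub>R v) p - (x + s *\<^sub>R v) q = x p - x q + s * (v p - v q)"
      by (simp add: scaleR_fun_def algebra_simps)
    have "(v p < v q \<longrightarrow> (p, q, a) \<notin> T) \<and> (v q < v p \<longrightarrow> (p, q, a) \<in> T)"
      using v(2) e unfolding increasing_along_forced_edges_iff[OF A T] by blast
    then have "if (p, q, a) \<in> T then 0 \<le> v p - v q else v p - v q \<le> 0"
      by auto
    then have "if (p, q, a) \<in> T then 0 \<le> s * (v p - v q) else s * (v p - v q) \<le> 0"
      using s by (auto intro: mult_nonneg_nonneg mult_nonneg_nonpos split: if_splits)
    then show ?thesis
      unfolding diff using diff_cell_sign[OF x e] by auto
  qed
  moreover have "x + s *\<^sub>R v \<in> topspace (Euclidean_space n)"
    using x v(1)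
    by (auto simp: diff_cell_iff intro: subspace_add subspace_scale subspace_Euclidean_space)
  ultimately show ?thesis
    using x unfolding diff_cell_iff by blast
qed

definition forced_rank :: "nat \<Rightarrow> real set \<Rightarrow> (nat \<times> nat \<times> real) set \<Rightarrow> nat \<Rightarrow> nat" where
  "forced_rank n A T = predecessor_count ((forced_edges n A T)\<^sup>*) {..<n}"

lemma forced_edges_semicomplete:
  assumes A: "finite A" "A \<noteq> {}" and T: "T \<in> diff_chambers n (diff_triples n A)"
    and "p < n" "q < n" "p \<noteq> q"
  shows "(p, q) \<in> forced_edges n A T \<or> (q, p) \<in> forced_edges n A T"
proof -
  obtain a where "a \<in> A"
    using A(2) by blast
  then consider "(p, q, a) \<in> diff_triples n A" | "(q, p, a) \<in> diff_triples n A"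
    using assms(4-6) by (auto simp: neq_iff)
  then show ?thesis
    by cases (use forced_edge_of_in_chamber[OF A T] forced_edge_of_notin_chamber[OF A T] in blast)+
qed

lemma forced_rank_le_iff:
  assumes "finite A" "A \<noteq> {}" "T \<in> diff_chambers n (diff_triples n A)" "i < n" "j < n"
  shows "forced_rank n A T i \<le> forced_rank n A T j \<longleftrightarrow> (i, j) \<in> (forced_edges n A T)\<^sup>*"
  unfolding forced_rank_def
proof (rule predecessor_count_le_iff)
  show "(p, q) \<in> (forced_edges n A T)\<^sup>* \<or> (q, p) \<in> (forced_edges n A T)\<^sup>*"
    if "p \<in> {..<n}" "q \<in> {..<n}" for p q
    using forced_edges_semicomplete[OF assms(1-3), of p q] that by (cases "p = q") auto
qed (use assms(4,5) in \<open>auto simp: refl_rtrancl trans_rtrancl\<close>)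

lemma increasing_along_forced_edges_iff_rank:
  fixes f :: "nat \<Rightarrow> 'b::preorder"
  assumes "finite A" "A \<noteq> {}" "T \<in> diff_chambers n (diff_triples n A)"
  shows "increasing_along (forced_edges n A T) f \<longleftrightarrow>
    (\<forall>i\<in>{..<n}. \<forall>j\<in>{..<n}. forced_rank n A T i \<le> forced_rank n A T j \<longrightarrow> f i \<le> f j)"
proof
  assume "increasing_along (forced_edges n A T) f"
  then have "increasing_along ((forced_edges n A T)\<^sup>*) f"
    by (simp add: increasing_along_rtrancl)
  then show "\<forall>i\<in>{..<n}. \<forall>j\<in>{..<n}. forced_rank n A T i \<le> forced_rank n A T j \<longrightarrow> f i \<le> f j"
    by (auto simp: forced_rank_le_iff[OF assms] increasing_along_def)
next
  assume mono: "\<forall>i\<in>{..<n}. \<forall>j\<in>{..<n}. forced_rank n A T i \<le> forced_rank n A T j \<longrightarrow> f i \<le> f j"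
  have "i < n" "j < n" "(i, j) \<in> (forced_edges n A T)\<^sup>*" if "(i, j) \<in> forced_edges n A T" for i j
    using that by (auto simp: forced_edges_def)
  then show "increasing_along (forced_edges n A T) f"
    using mono by (auto simp: forced_rank_le_iff[OF assms] increasing_along_def)
qed

section \<open>The level of a region\<close>

lemma bdd_above_forced_edges:
  assumes A: "finite A" "A \<noteq> {}" and "(i, j) \<in> (forced_edges n A T)\<^sup>*"
  shows "bdd_above ((\<lambda>x. x i - x j) ` diff_cell n (diff_triples n A) T)"
  using assms(3)
proof induction
  case base
  then show ?case
    by (intro bdd_aboveI[of _ 0]) auto
next
  case (step j k)
  then obtain K where K: "\<And>x. x \<in> diff_cell n (diff_triples n A) T \<Longrightarrow> x i - x j \<le> K"
    by (auto simp: bdd_above_def)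
  have "x i - x k \<le> K + max (- Min A) (Max A)"
    if x: "x \<in> diff_cell n (diff_triples n A) T" for x
  proof -
    have "x j - x k < Max A \<or> Min A < x k - x j"
      using step.hyps(2) diff_cell_sign(2)[OF x, of j k "Max A"]
        diff_cell_sign(1)[OF x, of k j "Min A"] A
      by (auto simp: forced_edges_def)
    then show ?thesis
      using K[OF x] by linarith
  qed
  then show ?case
    by (intro bdd_aboveI) auto
qed

lemma strong_components_bounded:
  assumes A: "finite A" "A \<noteq> {}" and T: "T \<in> diff_chambers n (diff_triples n A)"
  obtains M where "0 \<le> M"
    "\<And>x i j. x \<in> diff_cell n (diff_triples n A) T \<Longrightarrow> i < n \<Longrightarrow> j < n \<Longrightarrow>
      forced_rank n A T i = forced_rank n A T j \<Longrightarrow> \<bar>x i - x j\<bar> \<le> M"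
proof -
  let ?R = "diff_cell n (diff_triples n A) T"
  let ?P = "({..<n} \<times> {..<n}) \<inter> (forced_edges n A T)\<^sup>*"
  have "bdd_above (\<Union>p\<in>?P. (\<lambda>x. x (fst p) - x (snd p)) ` ?R)"
    using bdd_above_forced_edges[OF A] by (subst bdd_above_UN) auto
  then obtain M where M: "\<And>p x. p \<in> ?P \<Longrightarrow> x \<in> ?R \<Longrightarrow> x (fst p) - x (snd p) \<le> M"
    unfolding bdd_above_def by blast
  have "x i - x j \<le> \<bar>M\<bar>"
    if "x \<in> ?R" "i < n" "j < n" "forced_rank n A T i = forced_rank n A T j" for x i j
    using M[of "(i, j)" x] that forced_rank_le_iff[OF A T, of i j] by simp
  then show ?thesis
    by (intro that[of "\<bar>M\<bar>"]) (auto simp: abs_le_iff)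
qed

lemma diff_cell_subset_tube:
  assumes A: "finite A" "A \<noteq> {}" and T: "T \<in> diff_chambers n (diff_triples n A)"
  obtains r where "0 < r"
    "diff_cell n (diff_triples n A) T \<subseteq> tube n (fibre_constant_space n (forced_rank n A T)) r"
proof -
  let ?\<rho> = "forced_rank n A T"
  obtain M where M: "0 \<le> M"
    "\<And>x i j. x \<in> diff_cell n (diff_triples n A) T \<Longrightarrow> i < n \<Longrightarrow> j < n \<Longrightarrow>
      ?\<rho> i = ?\<rho> j \<Longrightarrow> \<bar>x i - x j\<bar> \<le> M"
    using strong_components_bounded[OF assms] by metis
  have "x \<in> tube n (fibre_constant_space n ?\<rho>) (real n * M + 1)"
    if x: "x \<in> diff_cell n (diff_triples n A) T" for x
  proof (rule tubeI)
    let ?rep = "inv_into {..<n} ?\<rho>"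
    define w where "w = (\<lambda>i. if i < n then x (?rep (?\<rho> i)) else 0)"
    have rep: "?rep (?\<rho> i) < n" "?\<rho> (?rep (?\<rho> i)) = ?\<rho> i" if "i < n" for i
      using that inv_into_into[of "?\<rho> i" ?\<rho> "{..<n}"] f_inv_into_f[of "?\<rho> i" ?\<rho> "{..<n}"] by auto
    show "x \<in> topspace (Euclidean_space n)"
      using x by (simp add: diff_cell_iff)
    show "w \<in> fibre_constant_space n ?\<rho>"
      unfolding fibre_constant_space_iff w_def by (rule exI[of _ "\<lambda>b. x (?rep b)"]) simp
    have "euclid_dist n x w \<le> (\<Sum>i<n. \<bar>x i - w i\<bar>)"
      unfolding euclid_dist_def by (rule L2_set_le_sum_abs)
    also have "\<dots> \<le> (\<Sum>i<n. M)"
      by (rule sum_mono) (auto simp: w_def rep intro!: M(2) x)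
    finally show "euclid_dist n x w \<le> real n * M + 1"
      by simp
  qed
  then show ?thesis
    using M(1) by (intro that[of "real n * M + 1"]) (auto simp: add_nonneg_pos)
qed

text \<open>The up-sets of the rank give directions of rays; their differences are the indicators of the
  strong components.\<close>

lemma fibre_constant_space_subset_tube_axis:
  assumes A: "finite A" "A \<noteq> {}" and T: "T \<in> diff_chambers n (diff_triples n A)"
    and W: "subspace W" "W \<subseteq> topspace (Euclidean_space n)"
    and tube: "diff_cell n (diff_triples n A) T \<subseteq> tube n W r"
  shows "fibre_constant_space n (forced_rank n A T) \<subseteq> W"
proof -
  let ?\<rho> = "forced_rank n A T"
  obtain x where x: "x \<in> diff_cell n (diff_triples n A) T"
    using T by (auto simp: in_chambers_iff_cell_nonempty)
  define v where "v b = (\<lambda>i. if i < n \<and> b \<le> ?\<rho> i then 1 else (0::real))" for b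
  have "v b \<in> W" for b
  proof (rule ray_in_tube_imp_direction_in_subspace[OF W])
    have "v b \<in> topspace (Euclidean_space n)"
      by (simp add: v_def topspace_Euclidean_space)
    moreover have "increasing_along (forced_edges n A T) (v b)"
      unfolding increasing_along_forced_edges_iff_rank[OF A T] by (auto simp: v_def)
    ultimately show "x + s *\<^sub>R v b \<in> tube n W r" if "0 \<le> s" for s
      using diff_cell_ray[OF A x] that tube by blast
  qed
  moreover have "fibre_indicator n ?\<rho> b = v b - v (Suc b)" for b
    by (auto simp: fibre_indicator_def v_def fun_eq_iff)
  ultimately have "fibre_indicator n ?\<rho> b \<in> W" for b
    using subspace_diff[OF W(1)] by simp
  then show ?thesis
    unfolding span_fibre_indicator[symmetric] by (intro span_minimal W(1)) auto
qed

lemma level_diff_cell: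
  assumes "finite A" "A \<noteq> {}" "T \<in> diff_chambers n (diff_triples n A)"
  shows "level n (diff_cell n (diff_triples n A) T) = card (forced_rank n A T ` {..<n})"
proof -
  obtain r where r: "0 < r"
    "diff_cell n (diff_triples n A) T \<subseteq> tube n (fibre_constant_space n (forced_rank n A T)) r"
    by (rule diff_cell_subset_tube[OF assms])
  have "level n (diff_cell n (diff_triples n A) T)
      = dim (fibre_constant_space n (forced_rank n A T))"
    by (rule level_eq_dim[OF subspace_fibre_constant_space _ r])
      (use fibre_constant_space_subset_tube_axis[OF assms] in \<open>auto simp: fibre_constant_space_def\<close>)
  then show ?thesis
    by (simp add: dim_fibre_constant_space)
qed

lemma level_diff_cell_le:
  assumes "finite A" "A \<noteq> {}" "T \<in> diff_chambers n (diff_triples n A)"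
  shows "level n (diff_cell n (diff_triples n A) T) \<le> n"
  unfolding level_diff_cell[OF assms] using card_image_le[of "{..<n}"] by simp

lemma card_functions_increasing_along_forced_edges:
  assumes "finite A" "A \<noteq> {}" "T \<in> diff_chambers n (diff_triples n A)"
  defines "l \<equiv> level n (diff_cell n (diff_triples n A) T)"
  shows "card {f \<in> {..<n} \<rightarrow>\<^sub>E {..<k::nat}. increasing_along (forced_edges n A T) f} =
    (k + l - 1) choose l"
  unfolding l_def level_diff_cell[OF assms(1-3)]
    increasing_along_forced_edges_iff_rank[OF assms(1-3)]
  by (simp add: card_rank_monotone_functions del: lessThan_iff)

section \<open>Colourings and monochromatic subarrangements\<close>

definition monochromatic_triples ::
    "nat \<Rightarrow> real set \<Rightarrow> (nat \<Rightarrow> nat) \<Rightarrow> (nat \<times> nat \<times> real) set" where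
  "monochromatic_triples n A f = {(i, j, a) \<in> diff_triples n A. f i = f j}"

lemma exists_coordinate_spread_bound:
  assumes "finite A"
  obtains M where "\<And>p q a. (p, q, a) \<in> diff_triples n A \<Longrightarrow> \<bar>x p - x q - a\<bar> < M"
proof
  let ?d = "\<lambda>(p, q, a). \<bar>x p - x q - a\<bar>"
  fix p q a assume "(p, q, a) \<in> diff_triples n A"
  then have "?d (p, q, a) \<le> (\<Sum>e\<in>diff_triples n A. ?d e)"
    by (rule member_le_sum) (auto simp: finite_diff_triples assms)
  then show "\<bar>x p - x q - a\<bar> < (\<Sum>e\<in>diff_triples n A. ?d e) + 1"
    by simp
qed

lemma sign_of_large_shift:
  fixes i j :: nat and a d M :: real
  assumes "\<bar>d - a\<bar> < M"
  shows "i < j \<Longrightarrow> d + M * (real i - real j) < a" "j < i \<Longrightarrow> a < d + M * (real i - real j)"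
proof -
  have "0 \<le> M"
    using assms by simp
  show "d + M * (real i - real j) < a" if "i < j"
    using mult_left_mono[OF _ \<open>0 \<le> M\<close>, of "real i - real j" "- 1"] assms that by auto
  show "a < d + M * (real i - real j)" if "j < i"
    using mult_left_mono[OF _ \<open>0 \<le> M\<close>, of 1 "real i - real j"] assms that by auto
qed

lemma shift_by_colours_in_diff_cell:
  assumes x: "x \<in> diff_cell n (monochromatic_triples n A f) T"
    and M: "\<And>p q a. (p, q, a) \<in> diff_triples n A \<Longrightarrow> \<bar>x p - x q - a\<bar> < M"
  shows "(\<lambda>i. if i < n then x i + M * real (f i) else 0) \<in>
    diff_cell n (diff_triples n A) (T \<union> {(p, q, a) \<in> diff_triples n A. f q < f p})"
    (is "?y \<in> diff_cell n ?I ?T")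
proof -
  have sub: "T \<subseteq> monochromatic_triples n A f"
    using x by (simp add: diff_cell_iff)
  have "if (p, q, a) \<in> ?T then a < ?y p - ?y q else ?y p - ?y q < a"
    if e: "(p, q, a) \<in> ?I" for p q a
  proof -
    have y: "?y p - ?y q = x p - x q + M * (real (f p) - real (f q))"
      using e by (simp add: algebra_simps)
    show ?thesis
    proof (cases "f p" "f q" rule: linorder_cases)
      case less
      then have "(p, q, a) \<notin> ?T"
        using sub by (auto simp: monochromatic_triples_def)
      then show ?thesis
        unfolding y using sign_of_large_shift(1)[OF M[OF e] less] by simp
    next
      case equal
      then have "(p, q, a) \<in> monochromatic_triples n A f" "(p, q, a) \<in> ?T \<longleftrightarrow> (p, q, a) \<in> T"
        using e by (auto simp: monochromatic_triples_def)
      then show ?thesis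
        unfolding y using diff_cell_sign[OF x, of p q a] equal by simp
    next
      case greater
      then show ?thesis
        unfolding y using sign_of_large_shift(2)[OF M[OF e] greater] e by simp
    qed
  qed
  moreover have "?y \<in> topspace (Euclidean_space n)"
    by (simp add: topspace_Euclidean_space)
  moreover have "?T \<subseteq> ?I"
    using sub by (auto simp: monochromatic_triples_def)
  ultimately show ?thesis
    unfolding diff_cell_iff by blast
qed

lemma monochromatic_chamber_extends:
  assumes A: "finite A" "A \<noteq> {}"
    and T: "T \<in> diff_chambers n (monochromatic_triples n A f)"
  obtains T' where "T' \<in> diff_chambers n (diff_triples n A)"
    "increasing_along (forced_edges n A T') f" "T' \<inter> monochromatic_triples n A f = T"
proof -
  define T' where "T' = T \<union> {(p, q, a) \<in> diff_triples n A. f q < f p}"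
  obtain x where x: "x \<in> diff_cell n (monochromatic_triples n A f) T"
    using T by (auto simp: in_chambers_iff_cell_nonempty)
  obtain M where "\<And>p q a. (p, q, a) \<in> diff_triples n A \<Longrightarrow> \<bar>x p - x q - a\<bar> < M"
    using exists_coordinate_spread_bound[OF A(1)] by metis
  then have T': "T' \<in> diff_chambers n (diff_triples n A)"
    using shift_by_colours_in_diff_cell[OF x, of M]
    unfolding in_chambers_iff_cell_nonempty T'_def by blast
  have sub: "T \<subseteq> monochromatic_triples n A f"
    using T chambers_subset_Pow by blast
  then have "increasing_along (forced_edges n A T') f"
    unfolding increasing_along_forced_edges_iff[OF A T']
    by (auto simp: T'_def monochromatic_triples_def)
  moreover have "T' \<inter> monochromatic_triples n A f = T"
    using sub by (auto simp: T'_def monochromatic_triples_def)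
  ultimately show ?thesis
    using T' by (intro that)
qed

lemma chamber_eq_monochromatic_part_Un:
  assumes "finite A" "A \<noteq> {}" and T: "T \<in> diff_chambers n (diff_triples n A)"
    and "increasing_along (forced_edges n A T) f"
  shows "T = (T \<inter> monochromatic_triples n A f) \<union> {(p, q, a) \<in> diff_triples n A. f q < f p}"
proof -
  have sub: "T \<subseteq> diff_triples n A"
    using T chambers_subset_Pow by blast
  have sorted: "(f p < f q \<longrightarrow> (p, q, a) \<notin> T) \<and> (f q < f p \<longrightarrow> (p, q, a) \<in> T)"
    if "(p, q, a) \<in> diff_triples n A" for p q a
    using assms(4) that unfolding increasing_along_forced_edges_iff[OF assms(1-3)] by blast
  have "(p, q, a) \<in> T \<longleftrightarrow> (p, q, a) \<in> diff_triples n A \<and> ((p, q, a) \<in> T \<and> f p = f q \<or> f q < f p)"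
    for p q a
    using sorted[of p q a] sub by (cases "f p" "f q" rule: linorder_cases) auto
  then show ?thesis
    by (auto simp: monochromatic_triples_def)
qed

lemma card_monochromatic_chambers:
  assumes A: "finite A" "A \<noteq> {}"
  shows "card (diff_chambers n (monochromatic_triples n A f)) =
    card {T \<in> diff_chambers n (diff_triples n A). increasing_along (forced_edges n A T) f}"
    (is "_ = card ?C")
proof -
  let ?J = "monochromatic_triples n A f"
  have "bij_betw (\<lambda>T. T \<inter> ?J) ?C (diff_chambers n ?J)"
  proof (rule bij_betw_imageI)
    show "inj_on (\<lambda>T. T \<inter> ?J) ?C"
      by (rule inj_onI) (metis (no_types, lifting) CollectD chamber_eq_monochromatic_part_Un[OF A])
    have "?J \<subseteq> diff_triples n A"
      by (auto simp: monochromatic_triples_def)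
    then have "(\<lambda>T. T \<inter> ?J) ` ?C \<subseteq> diff_chambers n ?J"
      using chambers_restrict by blast
    moreover have "diff_chambers n ?J \<subseteq> (\<lambda>T. T \<inter> ?J) ` ?C"
    proof
      fix T assume "T \<in> diff_chambers n ?J"
      then show "T \<in> (\<lambda>T. T \<inter> ?J) ` ?C"
        by (rule monochromatic_chamber_extends[OF A]) auto
    qed
    ultimately show "(\<lambda>T. T \<inter> ?J) ` ?C = diff_chambers n ?J"
      by (rule subset_antisym)
  qed
  then show ?thesis
    by (simp add: bij_betw_same_card)
qed

section \<open>The characteristic polynomial\<close>

definition diff_hyperplane :: "nat \<Rightarrow> nat \<times> nat \<times> real \<Rightarrow> (nat \<Rightarrow> real) set" where
  "diff_hyperplane n e = {x \<in> topspace (Euclidean_space n). diff_form e x = diff_const e}"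

abbreviation diff_flat :: "nat \<Rightarrow> (nat \<times> nat \<times> real) set \<Rightarrow> (nat \<Rightarrow> real) set" where
  "diff_flat n B \<equiv> flat n (diff_hyperplane n ` B)"

lemma difference_arrangement_eq: "difference_arrangement n A = diff_hyperplane n ` diff_triples n A"
proof -
  have "difference_arrangement n A
      = {diff_hyperplane n (i, j, a) | i j a. (i, j, a) \<in> diff_triples n A}"
    by (simp add: difference_arrangement_def diff_hyperplane_def)
  also have "\<dots> = diff_hyperplane n ` diff_triples n A"
    by (auto simp del: diff_triples_iff)
  finally show ?thesis .
qed

lemma diff_flat_eq:
  "diff_flat n B = topspace (Euclidean_space n) \<inter> {x. \<forall>e\<in>B. diff_form e x = diff_const e}"
  by (auto simp: flat_def diff_hyperplane_def)

lemma diff_hyperplane_subset_imp_eq: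
  assumes ij: "i < j" "j < n" and kl: "k < l" "l < n"
    and sub: "diff_hyperplane n (i, j, a) \<subseteq> diff_hyperplane n (k, l, b)"
  shows "(i, j, a) = (k, l, b)"
proof -
  have difference: "x k - x l = b" if "\<forall>m\<ge>n. x m = 0" "x i - x j = a" for x
    using that sub by (auto simp: diff_hyperplane_def topspace_Euclidean_space)
  define y where "y = (\<lambda>m. if m = i then a else 0)"
  have y: "y k - y l = b"
    by (rule difference) (use ij in \<open>auto simp: y_def\<close>)
  have "m \<in> {i, j}" if m: "m \<in> {k, l}" for m
  proof (rule ccontr)
    assume "m \<notin> {i, j}"
    then have "(y(m := y m + 1)) k - (y(m := y m + 1)) l = b"
      by (intro difference) (use ij kl m in \<open>auto simp: y_def\<close>)
    then show False
      using y m kl by (auto split: if_splits)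
  qed
  from this[of k] this[of l] have "k = i" "l = j"
    using ij kl by auto
  then show ?thesis
    using y kl by (simp add: y_def)
qed

lemma inj_on_diff_hyperplane: "inj_on (diff_hyperplane n) (diff_triples n A)"
proof (rule inj_onI)
  fix e e'
  assume e: "e \<in> diff_triples n A" "e' \<in> diff_triples n A"
    and eq: "diff_hyperplane n e = diff_hyperplane n e'"
  obtain i j a k l b where "e = (i, j, a)" "e' = (k, l, b)"
    by (cases e, cases e') auto
  then show "e = e'"
    using e eq diff_hyperplane_subset_imp_eq[of i j n k l a b] by simp
qed

lemma poly_arrangement_poly_image:
  assumes "finite I" "inj_on H I"
  shows "poly (arrangement_poly n (H ` I)) t = (\<Sum>B\<in>Pow I.
    if flat n (H ` B) = {} then 0 else (-1) ^ card B * t ^ affine_dim (flat n (H ` B)))"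
proof -
  let ?g = "\<lambda>C. if flat n C = {} then 0 else (-1) ^ card C * t ^ affine_dim (flat n C)"
  have "poly (arrangement_poly n (H ` I)) t
      = (\<Sum>C | C \<in> Pow (H ` I) \<and> flat n C \<noteq> {}. (-1) ^ card C * t ^ affine_dim (flat n C))"
    by (simp add: arrangement_poly_def poly_sum poly_monom)
  also have "\<dots> = (\<Sum>C\<in>Pow (H ` I). ?g C)"
    using assms(1) by (subst sum.inter_filter) (auto intro: sum.cong)
  also have "\<dots> = (\<Sum>B\<in>Pow I. ?g (H ` B))"
    unfolding image_Pow_surj[of H I, OF refl, symmetric]
    by (rule sum.reindex_cong[OF inj_on_image_Pow[OF assms(2)]]) auto
  also have "\<dots> = (\<Sum>B\<in>Pow I.
      if flat n (H ` B) = {} then 0 else (-1) ^ card B * t ^ affine_dim (flat n (H ` B)))"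
    using inj_on_subset[OF assms(2)] by (intro sum.cong) (auto simp: card_image)
  finally show ?thesis .
qed

definition edge_set :: "(nat \<times> nat \<times> real) set \<Rightarrow> (nat \<times> nat) set" where
  "edge_set B = (\<lambda>(i, j, a). (i, j)) ` B"

lemma edge_set_subset: "B \<subseteq> diff_triples n A \<Longrightarrow> edge_set B \<subseteq> {..<n} \<times> {..<n}"
  by (auto simp: edge_set_def)

lemma affine_dim_diff_flat:
  assumes B: "B \<subseteq> diff_triples n A" and "diff_flat n B \<noteq> {}"
  shows "affine_dim (diff_flat n B) = card (edge_class (edge_set B) ` {..<n})"
proof -
  let ?U = "fibre_constant_space n (edge_class (edge_set B))"
  obtain x where x: "x \<in> diff_flat n B"
    using assms(2) by blast
  have directions: "u \<in> ?U \<longleftrightarrow> u \<in> topspace (Euclidean_space n) \<and> (\<forall>(i, j, a)\<in>B. u i = u j)" for u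
    using constant_along_edges_iff[OF edge_set_subset[OF B], of u]
    by (auto simp: fibre_constant_space_def edge_set_def)
  have "x + u \<in> diff_flat n B \<longleftrightarrow> u \<in> ?U" for u
  proof -
    have "x + u \<in> topspace (Euclidean_space n) \<longleftrightarrow> u \<in> topspace (Euclidean_space n)"
      using x by (auto simp: diff_flat_eq topspace_Euclidean_space)
    moreover have "diff_form (i, j, a) (x + u) = diff_const (i, j, a) \<longleftrightarrow> u i = u j"
      if "(i, j, a) \<in> B" for i j a
      using x that by (auto simp: diff_flat_eq)
    ultimately show ?thesis
      unfolding directions diff_flat_eq by auto
  qed
  then have "diff_flat n B = (+) x ` ?U"
    by (auto simp: image_iff) (metis add_diff_cancel_left' diff_add_cancel add.commute)
  then show ?thesis
    by (simp add: affine_dim_translation subspace_fibre_constant_space dim_fibre_constant_space)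
qed

lemma card_colourings_monochromatic_on:
  assumes B: "B \<subseteq> diff_triples n A" and "diff_flat n B \<noteq> {}"
  shows "card {f \<in> {..<n} \<rightarrow>\<^sub>E {..<k::nat}. B \<subseteq> monochromatic_triples n A f} =
    k ^ affine_dim (diff_flat n B)"
proof -
  have "B \<subseteq> monochromatic_triples n A f \<longleftrightarrow> (\<forall>(i, j)\<in>edge_set B. f i = f j)" for f
    using B by (auto simp: monochromatic_triples_def edge_set_def)
  then show ?thesis
    unfolding constant_along_edges_iff[OF edge_set_subset[OF B]]
    by (simp add: card_constant_on_fibres affine_dim_diff_flat[OF assms])
qed

lemma signed_flat_Euclidean_space: "signed_flat (topspace (Euclidean_space n)) = (-1) ^ n"
  using subspace_0[OF subspace_Euclidean_space, of n]
  by (auto simp: signed_flat_def affine_dim_subspace subspace_Euclidean_space dim_Euclidean_space)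

lemma sum_monochromatic_flats:
  assumes "finite A"
  shows "(\<Sum>B\<in>Pow (monochromatic_triples n A f). (-1) ^ card B * signed_flat (diff_flat n B)) =
    (-1) ^ n * real (card (diff_chambers n (monochromatic_triples n A f)))"
proof -
  obtain S where S: "finite S" "topspace (Euclidean_space n) = span S"
    by (rule Euclidean_space_finite_span)
  have "monochromatic_triples n A f \<subseteq> diff_triples n A"
    by (auto simp: monochromatic_triples_def)
  then have "finite (monochromatic_triples n A f)"
    using finite_diff_triples[OF assms] by (rule finite_subset)
  then have "alternating_flat_sum diff_form diff_const (monochromatic_triples n A f)
        (topspace (Euclidean_space n))
      = signed_chamber_count diff_form diff_const (monochromatic_triples n A f)
        (topspace (Euclidean_space n))"
    using S by (intro zaslavsky[of _ S]) (auto simp: subspace_imp_affine linear_diff_form)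
  then show ?thesis
    by (simp add: alternating_flat_sum_def signed_chamber_count_def diff_flat_eq
        signed_flat_Euclidean_space)
qed

lemma poly_arrangement_poly_neg:
  assumes A: "finite A"
  shows "poly (arrangement_poly n (difference_arrangement n A)) (- real k) =
    (-1) ^ n * (\<Sum>f\<in>{..<n} \<rightarrow>\<^sub>E {..<k}. real (card (diff_chambers n (monochromatic_triples n A f))))"
proof -
  let ?I = "diff_triples n A" and ?J = "monochromatic_triples n A"
  let ?F = "{..<n} \<rightarrow>\<^sub>E {..<k}"
  let ?w = "\<lambda>B. (-1) ^ card B * signed_flat (diff_flat n B)"
  have finI: "finite ?I"
    using A by (rule finite_diff_triples)
  have "(if diff_flat n B = {} then 0 else (-1) ^ card B * (- real k) ^ affine_dim (diff_flat n B))
      = (\<Sum>f | f \<in> ?F \<and> B \<subseteq> ?J f. ?w B)" if "B \<in> Pow ?I" for B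
    using card_colourings_monochromatic_on[of B n A k] that
    by (auto simp: signed_flat_def power_minus[of "real k"])
  then have "poly (arrangement_poly n (difference_arrangement n A)) (- real k)
      = (\<Sum>B\<in>Pow ?I. \<Sum>f | f \<in> ?F \<and> B \<subseteq> ?J f. ?w B)"
    unfolding difference_arrangement_eq poly_arrangement_poly_image[OF finI inj_on_diff_hyperplane]
    by (rule sum.cong[OF refl])
  also have "\<dots> = (\<Sum>f\<in>?F. \<Sum>B | B \<in> Pow ?I \<and> B \<subseteq> ?J f. ?w B)"
    by (rule sum.swap_restrict) (use finI in \<open>auto simp: finite_PiE\<close>)
  also have "\<dots> = (\<Sum>f\<in>?F. \<Sum>B\<in>Pow (?J f). ?w B)"
    by (intro sum.cong) (auto simp: monochromatic_triples_def)
  also have "\<dots> = (-1) ^ n * (\<Sum>f\<in>?F. real (card (diff_chambers n (?J f))))"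
    by (simp add: sum_monochromatic_flats[OF A] sum_distrib_left)
  finally show ?thesis .
qed

lemma sum_card_monochromatic_chambers:
  fixes n :: nat
  assumes A: "finite A" "A \<noteq> {}"
  defines "l \<equiv> \<lambda>T. level n (diff_cell n (diff_triples n A) T)"
  shows "(\<Sum>f\<in>{..<n} \<rightarrow>\<^sub>E {..<k}. card (diff_chambers n (monochromatic_triples n A f))) =
    (\<Sum>T\<in>diff_chambers n (diff_triples n A). (k + l T - 1) choose l T)"
proof -
  let ?F = "{..<n} \<rightarrow>\<^sub>E {..<k}" and ?C = "diff_chambers n (diff_triples n A)"
  have "(\<Sum>f\<in>?F. card (diff_chambers n (monochromatic_triples n A f)))
      = (\<Sum>f\<in>?F. \<Sum>T | T \<in> ?C \<and> increasing_along (forced_edges n A T) f. 1)"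
    by (simp add: card_monochromatic_chambers[OF A])
  also have "\<dots> = (\<Sum>T\<in>?C. \<Sum>f | f \<in> ?F \<and> increasing_along (forced_edges n A T) f. 1)"
    using A(1)
    by (intro sum.swap_restrict) (auto simp: finite_PiE finite_chambers finite_diff_triples)
  also have "\<dots> = (\<Sum>T\<in>?C. (k + l T - 1) choose l T)"
    unfolding l_def
    by (rule sum.cong) (simp_all add: card_functions_increasing_along_forced_edges[OF A])
  finally show ?thesis .
qed

section \<open>Counting regions by level\<close>

lemma num_regions_difference_arrangement:
  "num_regions n (difference_arrangement n A) l =
    card {T \<in> diff_chambers n (diff_triples n A). level n (diff_cell n (diff_triples n A) T) = l}"
    (is "_ = card ?C")
proof -
  have "regions n (difference_arrangement n A)
      = diff_cell n (diff_triples n A) ` diff_chambers n (diff_triples n A)"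
    unfolding difference_arrangement_eq diff_hyperplane_def
    by (rule regions_eq_chamber_cells) (simp_all add: linear_diff_form continuous_on_diff_form)
  then have "{R \<in> regions n (difference_arrangement n A). level n R = l}
      = diff_cell n (diff_triples n A) ` ?C"
    by auto
  moreover have "inj_on (diff_cell n (diff_triples n A)) ?C"
    by (rule inj_on_subset[OF inj_on_chamber_cell]) auto
  ultimately show ?thesis
    unfolding num_regions_def by (simp add: card_image)
qed

lemma sum_num_regions:
  fixes g :: "nat \<Rightarrow> real"
  assumes A: "finite A" "A \<noteq> {}"
  shows "(\<Sum>l=0..n. g l * real (num_regions n (difference_arrangement n A) l)) =
    (\<Sum>T\<in>diff_chambers n (diff_triples n A). g (level n (diff_cell n (diff_triples n A) T)))"
proof -
  let ?C = "diff_chambers n (diff_triples n A)"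
  let ?l = "\<lambda>T. level n (diff_cell n (diff_triples n A) T)"
  have "(\<Sum>l=0..n. g l * real (num_regions n (difference_arrangement n A) l))
      = (\<Sum>l=0..n. \<Sum>T | T \<in> ?C \<and> ?l T = l. g (?l T))"
    by (simp add: num_regions_difference_arrangement mult.commute)
  also have "\<dots> = (\<Sum>T\<in>?C. g (?l T))"
    using A(1)
    by (intro sum.group) (auto simp: finite_chambers finite_diff_triples level_diff_cell_le[OF A])
  finally show ?thesis .
qed

lemma gbinomial_neg_of_nat_Suc:
  "(- real (Suc k) gchoose l) = (-1) ^ l * real ((Suc k + l - 1) choose l)"
proof -
  have "real l - (- real (Suc k)) - 1 = real (Suc k + l - 1)"
    by simp
  then show ?thesis
    unfolding gbinomial_negated_upper[of "- real (Suc k)"] binomial_gbinomial by metis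
qed

lemma expansion_at_negative_integers:
  assumes A: "finite A" "A \<noteq> {}"
  shows "poly (arrangement_poly n (difference_arrangement n A)) (- real (Suc k)) =
    (\<Sum>l=0..n. (-1) ^ (n - l) * real (num_regions n (difference_arrangement n A) l)
      * (- real (Suc k) gchoose l))"
proof -
  let ?r = "\<lambda>l. real (num_regions n (difference_arrangement n A) l)"
  have sign: "(-1) ^ (n - l) * (- real (Suc k) gchoose l)
      = (-1) ^ n * real ((Suc k + l - 1) choose l)" if "l \<le> n" for l
    unfolding gbinomial_neg_of_nat_Suc using that
    by (simp add: mult.assoc[symmetric] flip: power_add)
  have "poly (arrangement_poly n (difference_arrangement n A)) (- real (Suc k))
      = (-1) ^ n * (\<Sum>l=0..n. real ((Suc k + l - 1) choose l) * ?r l)"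
    unfolding poly_arrangement_poly_neg[OF A(1)] sum_num_regions[OF A] of_nat_sum[symmetric]
      sum_card_monochromatic_chambers[OF A] ..
  also have "\<dots> = (\<Sum>l=0..n. (-1) ^ (n - l) * (- real (Suc k) gchoose l) * ?r l)"
    unfolding sum_distrib_left by (rule sum.cong) (simp_all only: sign mult.assoc atLeastAtMost_iff)
  finally show ?thesis
    by (simp only: mult_ac)
qed

definition gbinomial_poly :: "nat \<Rightarrow> real poly" where
  "gbinomial_poly l = smult (1 / fact l) (\<Prod>i=0..<l. [:- of_nat i, 1:])"

lemma poly_gbinomial_poly: "poly (gbinomial_poly l) t = (t gchoose l)"
  by (simp add: gbinomial_poly_def gbinomial_prod_rev poly_prod)

lemma poly_eq_if_eq_at_negative_integers:
  fixes p q :: "real poly"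
  assumes "\<And>k. poly p (- real (Suc k)) = poly q (- real (Suc k))"
  shows "p = q"
proof -
  have "range (\<lambda>k. - real (Suc k)) \<subseteq> {t. poly (p - q) t = 0}"
    using assms by (auto simp del: of_nat_Suc)
  moreover have "infinite (range (\<lambda>k. - real (Suc k)))"
    by (intro range_inj_infinite) (auto simp: inj_def)
  ultimately have "infinite {t. poly (p - q) t = 0}"
    using finite_subset by blast
  then show ?thesis
    using poly_roots_finite[of "p - q"] by auto
qed

theorem theorem1p2:
  fixes A :: "real set" and n :: nat and t :: real
  assumes "finite A" and "A \<noteq> {}"
  shows "poly (arrangement_poly n (difference_arrangement n A)) t =
    (\<Sum>l=0..n. (-1) ^ (n - l) * real (num_regions n (difference_arrangement n A) l) * (t gchoose l))"
proof -
  define q where "q = (\<Sum>l=0..n.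
    smult ((-1) ^ (n - l) * real (num_regions n (difference_arrangement n A) l))
      (gbinomial_poly l))"
  have q: "poly q t = (\<Sum>l=0..n.
    (-1) ^ (n - l) * real (num_regions n (difference_arrangement n A) l) * (t gchoose l))" for t
    by (simp add: q_def poly_sum poly_gbinomial_poly)
  have "arrangement_poly n (difference_arrangement n A) = q"
    by (rule poly_eq_if_eq_at_negative_integers)
      (simp only: q expansion_at_negative_integers[OF assms])
  then show ?thesis
    by (simp add: q)
qed

end
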